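(* The $\star$-insertion is a bijection from the set of all fully-commutative decreasing Hecke biwords to the set of all pairs $(P,Q)$ of tableaux of the same shape such that $P^t$ and $Q$ are semistandard and $\mathsf{row}(P)$ is fully-commutative.
   Context: The 0-Hecke monoid: words in positive integers modulo the equivalence generated by $pq=qp$ ($|p-q|>1$), $pqp=qpq$, $pp=p$ on consecutive subwords; a word is fully-commutative if no minimal-length word equivalent to it contains a consecutive subword $i(i+1)i$ or $i(i-1)i$. A fully-commutative decreasing Hecke biword is a two-row array with columns $[k_1;h_1],\dots,[k_N;h_N]$ (positive integers) such that $k_1\geqslant\cdots\geqslant k_N$, $h_j>h_{j+1}$ whenever $k_j=k_{j+1}$, and $h_1\cdots h_N$ is fully-commutative. Tableaux are in French notation (rows numbered from the bottom), with positive integer entries. $P^t$ semistandard means rows of $P$ strictly increase left to right and columns weakly increase bottom to top; $Q$ semistandard means rows weakly increase and columns strictly increase. $\mathsf{row}(P)$ reads rows from the top row down, each left to right. $\star$-insertion: read columns right to left, starting with $P,Q$ empty. For column $[q;x]$, insert $x$ into the bottom row of $P$, where inserting a letter $x$ into a row $R$ means: Case 1: if $R$ is empty or $x>\max(R)$, append $x$ to $R$, add a cell with entry $q$ to $Q$ in the same position, and stop. Case 2: otherwise if $x\notin R$, let $y$ be the smallest entry of $R$ with $y>x$, replace $y$ by $x$, and insert $y$ into the next row up. Case 3: if $x\in R$, let $y$ be the smallest entry of $R$ with $[y,x]\subseteq R$; $R$ is unchanged and $y$ is inserted into the next row up. The output is $\star([\mathbf{k},\mathbf{h}]^t)=(P,Q)$.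 *)

theory Defs
  imports "HOL-Library.Sublist"
begin

inductive hecke_step :: "nat list \<Rightarrow> nat list \<Rightarrow> bool" where
  comm: "p + 1 < q \<or> q + 1 < p \<Longrightarrow> hecke_step (u @ [p, q] @ v) (u @ [q, p] @ v)"
| braid: "hecke_step (u @ [p, q, p] @ v) (u @ [q, p, q] @ v)"
| idem: "hecke_step (u @ [p, p] @ v) (u @ [p] @ v)"

definition hecke_equiv :: "nat list \<Rightarrow> nat list \<Rightarrow> bool" where
  "hecke_equiv = equivclp hecke_step"

definition hecke_reduced :: "nat list \<Rightarrow> bool" where
  "hecke_reduced v \<longleftrightarrow> (\<forall>u. hecke_equiv u v \<longrightarrow> length v \<le> length u)"

definition fully_commutative :: "nat list \<Rightarrow> bool" where
  "fully_commutative w \<longleftrightarrow>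
     (\<forall>v. hecke_equiv v w \<and> hecke_reduced v \<longrightarrow>
        (\<forall>i. \<not> sublist [i, i + 1, i] v \<and> \<not> sublist [i + 1, i, i + 1] v))"

text \<open>A biword is the list of its columns, each a pair (top entry, bottom entry).\<close>

definition fc_decreasing_biwords :: "(nat \<times> nat) list set" where
  "fc_decreasing_biwords =
     {w. (\<forall>(k, h) \<in> set w. 0 < k \<and> 0 < h) \<and>
         (\<forall>j. j + 1 < length w \<longrightarrow> fst (w ! j) \<ge> fst (w ! (j + 1))) \<and>
         (\<forall>j. j + 1 < length w \<longrightarrow> fst (w ! j) = fst (w ! (j + 1)) \<longrightarrow>
            snd (w ! j) > snd (w ! (j + 1))) \<and>
         fully_commutative (map snd w)}"

text \<open>A tableau is the list of its rows from bottom to top (French notation); there are no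
  empty rows, so the empty tableau is the empty list.\<close>

type_synonym tableau = "nat list list"

definition shape :: "tableau \<Rightarrow> nat list" where
  "shape T = map length T"

definition is_tableau :: "tableau \<Rightarrow> bool" where
  "is_tableau T \<longleftrightarrow>
     (\<forall>R \<in> set T. R \<noteq> [] \<and> (\<forall>x \<in> set R. 0 < x)) \<and> sorted_wrt (\<ge>) (shape T)"

definition semistandard :: "tableau \<Rightarrow> bool" where
  "semistandard T \<longleftrightarrow> is_tableau T \<and>
     (\<forall>R \<in> set T. sorted_wrt (\<le>) R) \<and>
     (\<forall>i j. i + 1 < length T \<and> j < length (T ! (i + 1)) \<longrightarrow> T ! i ! j < T ! (i + 1) ! j)"

definition transpose_semistandard :: "tableau \<Rightarrow> bool" where
  "transpose_semistandard T \<longleftrightarrow> is_tableau T \<and>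
     (\<forall>R \<in> set T. sorted_wrt (<) R) \<and>
     (\<forall>i j. i + 1 < length T \<and> j < length (T ! (i + 1)) \<longrightarrow> T ! i ! j \<le> T ! (i + 1) ! j)"

definition row_word :: "tableau \<Rightarrow> nat list" where
  "row_word T = concat (rev T)"

text \<open>Insertion of a letter into the bottom row of a tableau, returning the new tableau together
  with the index (counted from 0 at the bottom) of the row whose end receives the new cell. The
  first equation is the insertion into an empty row on top of the tableau.\<close>

fun star_insert_letter :: "nat \<Rightarrow> tableau \<Rightarrow> tableau \<times> nat" where
  "star_insert_letter x [] = ([[x]], 0)"
| "star_insert_letter x (R # P) =
     (if R = [] \<or> x > Max (set R) then ((R @ [x]) # P, 0)
      else if x \<notin> set R then
        (let y = Min {z \<in> set R. z > x};
             (P', r) = star_insert_letter y P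
         in (map (\<lambda>z. if z = y then x else z) R # P', Suc r))
      else
        (let y = Min {z \<in> set R. z \<le> x \<and> {z..x} \<subseteq> set R};
             (P', r) = star_insert_letter y P
         in (R # P', Suc r)))"

definition add_cell :: "nat \<Rightarrow> nat \<Rightarrow> tableau \<Rightarrow> tableau" where
  "add_cell r q Q = (if r < length Q then Q[r := Q ! r @ [q]] else Q @ [[q]])"

definition star_insert_column :: "nat \<times> nat \<Rightarrow> tableau \<times> tableau \<Rightarrow> tableau \<times> tableau" where
  "star_insert_column = (\<lambda>(q, x) (P, Q).
     (let (P', r) = star_insert_letter x P in (P', add_cell r q Q)))"

text \<open>The use of \<^const>\<open>foldr\<close> means that the columns are read from right to left.\<close>

definition star_insertion :: "(nat \<times> nat) list \<Rightarrow> tableau \<times> tableau" where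
  "star_insertion w = foldr star_insert_column w ([], [])"

definition fc_tableau_pairs :: "(tableau \<times> tableau) set" where
  "fc_tableau_pairs =
     {(P, Q). shape P = shape Q \<and> transpose_semistandard P \<and> semistandard Q \<and>
        fully_commutative (row_word P)}"

end

theory Submission
  imports Defs
begin

text \<open>A word is fully commutative iff no factor \<open>i v i\<close> with \<open>i\<close> not in \<open>v\<close> has exactly one of the
  two neighbours \<open>i - 1\<close>, \<open>i + 1\<close> occurring in \<open>v\<close>; this condition is invariant under all Hecke
  relations and passes to factors. Inserting \<open>x\<close> into a row \<open>R\<close> that bumps \<open>y\<close> and leaves \<open>R'\<close>
  satisfies \<open>R x \<equiv> y R'\<close>, so the row word of \<open>P\<close> is equivalent to the reversed bottom word, and the
  factor condition forces \<open>x + 1\<close> to be absent from \<open>R\<close> whenever \<open>x\<close> is present. This makes the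
  row step reversible and monotone: for consecutive insertions of \<open>x\<close> and \<open>x'\<close> the second new
  cell lies in a strictly higher row iff \<open>x' \<le> x\<close>. Hence the cell added last is always the lowest
  row end of \<open>Q\<close> carrying its maximal entry, and insertion can be undone cell by cell.\<close>

section \<open>Full commutativity via factors\<close>

text \<open>Full commutativity is tested on reduced words, while insertion produces row words with
  repetitions, so a criterion that can be read off any word is needed. Between two consecutive
  copies of \<open>i\<close>, no neighbour lets the copies merge, both neighbours separate them
  harmlessly (as in \<open>2 1 3 2\<close>), and a single neighbour, however often repeated, leads
  to a braid. Counting distinct neighbours instead of occurrences is what makes the condition
  compatible with \<open>pp = p\<close>. Case 3 is reversible because the two ends of a run
  determine each other: goodness of \<open>R x\<close> excludes \<open>x + 1\<close> from
  \<open>R\<close>, and goodness of \<open>y R'\<close> excludes \<open>y - 1\<close> from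
  \<open>R'\<close>. Within a block of equal top entries the bottom letters decrease from left to
  right, but columns are read from right to left, so the letters of a block enter in increasing
  order and their cells move weakly downwards. Hence, among the row ends carrying the maximal entry,
  the lowest one is the most recent.\<close>

definition adj :: "nat \<Rightarrow> nat \<Rightarrow> bool" where
  "adj p q \<longleftrightarrow> Suc p = q \<or> Suc q = p"

definition good :: "nat list \<Rightarrow> bool" where
  "good w \<longleftrightarrow> (\<forall>u v t i. w = u @ i # v @ i # t \<longrightarrow> i \<notin> set v \<longrightarrow>
     \<not> (\<exists>!q. adj i q \<and> q \<in> set v))"

lemma goodD: "good (u @ i # v @ i # t) \<Longrightarrow> i \<notin> set v \<Longrightarrow> \<not> (\<exists>!q. adj i q \<and> q \<in> set v)"
  unfolding good_def by blast

lemma good_factor: "good (a @ w @ b) \<Longrightarrow> good w"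
  unfolding good_def
proof (intro allI impI)
  fix u v t i
  assume g: "\<forall>u v t i. a @ w @ b = u @ i # v @ i # t \<longrightarrow> i \<notin> set v \<longrightarrow>
     \<not> (\<exists>!q. adj i q \<and> q \<in> set v)"
    and w: "w = u @ i # v @ i # t" and i: "i \<notin> set v"
  have "a @ w @ b = (a @ u) @ i # v @ i # (t @ b)" using w by simp
  then show "\<not> (\<exists>!q. adj i q \<and> q \<in> set v)" using g i by blast
qed

lemma good_rev: "good w \<Longrightarrow> good (rev w)"
  unfolding good_def
proof (intro allI impI)
  fix u v t i
  assume g: "\<forall>u v t i. w = u @ i # v @ i # t \<longrightarrow> i \<notin> set v \<longrightarrow>
     \<not> (\<exists>!q. adj i q \<and> q \<in> set v)"
    and w: "rev w = u @ i # v @ i # t" and i: "i \<notin> set v"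
  have "w = rev (u @ i # v @ i # t)" using w by (metis rev_rev_ident)
  then have "w = rev t @ i # rev v @ i # rev u" by simp
  then have "\<not> (\<exists>!q. adj i q \<and> q \<in> set (rev v))" using g i by (metis set_rev)
  then show "\<not> (\<exists>!q. adj i q \<and> q \<in> set v)" by simp
qed

text \<open>An automaton recognising bad factors for the letter \<open>i\<close>: its state records which of
  the two neighbours of \<open>i\<close> occurred since the last \<open>i\<close>. Invariance under the Hecke relations
  then reduces to identities between the transition functions.\<close>

datatype scan = Unseen | Seen bool bool | Bad

definition scan_step :: "nat \<Rightarrow> nat \<Rightarrow> scan \<Rightarrow> scan" where
  "scan_step i z s = (case s of Bad \<Rightarrow> Bad
     | Unseen \<Rightarrow> if z = i then Seen False False else Unseen
     | Seen a b \<Rightarrow> if z = i then (if a = b then Seen False False else Bad)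
         else if Suc z = i then Seen True b else if z = Suc i then Seen a True else s)"

definition scan_word :: "nat \<Rightarrow> nat list \<Rightarrow> scan \<Rightarrow> scan" where
  "scan_word i w s = foldl (\<lambda>s z. scan_step i z s) s w"

lemma scan_word_simps [simp]:
  "scan_word i [] s = s"
  "scan_word i (z # w) s = scan_word i w (scan_step i z s)"
  "scan_word i (u @ w) s = scan_word i w (scan_word i u s)"
  by (simp_all add: scan_word_def)

lemma scan_word_Bad [simp]: "scan_word i w Bad = Bad"
  by (induction w) (auto simp: scan_step_def)

lemma scan_word_Seen:
  "i \<notin> set v \<Longrightarrow> scan_word i v (Seen a b) =
     Seen (a \<or> (\<exists>z. Suc z = i \<and> z \<in> set v)) (b \<or> Suc i \<in> set v)"
  by (induction v arbitrary: a b) (auto simp: scan_step_def)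

lemma scan_step_self: "scan_step i i s = Bad \<or> scan_step i i s = Seen False False"
  by (auto simp: scan_step_def split: scan.splits)

text \<open>The two bits of \<open>Seen\<close> record the two neighbours, and exactly one is
  present iff the bits differ. The predecessor is expressed by an existential since
  \<open>i - 1\<close> would be \<open>i\<close> itself at \<open>i = 0\<close>.\<close>

lemma ex1_adj_iff:
  "(\<exists>!q. adj i q \<and> q \<in> A) \<longleftrightarrow> ((\<exists>z. Suc z = i \<and> z \<in> A) \<noteq> (Suc i \<in> A))"
proof (cases i)
  case 0
  then show ?thesis by (auto simp: adj_def)
next
  case (Suc j)
  then have "adj i q \<longleftrightarrow> q = j \<or> q = Suc i" for q by (auto simp: adj_def)
  moreover have "j \<noteq> Suc i" using Suc by simp
  moreover have "(\<exists>z. Suc z = i \<and> z \<in> A) \<longleftrightarrow> j \<in> A" using Suc by auto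
  ultimately show ?thesis by (cases "j \<in> A"; cases "Suc i \<in> A") auto
qed

text \<open>The state describes the factor after the most recent \<open>i\<close>, hence the
  induction by appending letters; entering \<open>Bad\<close> closes a factor that violates
  \<open>good\<close>.\<close>

lemma scan_word_cases:
  "(scan_word i w Unseen = Unseen \<longrightarrow> i \<notin> set w) \<and>
   (\<forall>a b. scan_word i w Unseen = Seen a b \<longrightarrow> (\<exists>u v. w = u @ i # v \<and> i \<notin> set v \<and>
        a = (\<exists>z. Suc z = i \<and> z \<in> set v) \<and> b = (Suc i \<in> set v))) \<and>
   (scan_word i w Unseen = Bad \<longrightarrow> \<not> good w)"
proof (induction w rule: rev_induct)
  case (snoc x w)
  show ?case
  proof (cases "scan_word i w Unseen")
    case Unseen
    then have i: "i \<notin> set w" using snoc by simp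
    show ?thesis
    proof (cases "x = i")
      case True
      then have "w @ [x] = w @ i # []" by simp
      moreover have "scan_word i (w @ [x]) Unseen = Seen False False"
        using Unseen True by (simp add: scan_step_def)
      ultimately show ?thesis by fastforce
    next
      case False
      then show ?thesis using Unseen i by (simp add: scan_step_def)
    qed
  next
    case (Seen a b)
    then obtain u v where w: "w = u @ i # v" "i \<notin> set v"
      "a = (\<exists>z. Suc z = i \<and> z \<in> set v)" "b = (Suc i \<in> set v)" using snoc by blast
    consider "x = i" "a = b" | "x = i" "a \<noteq> b" | "x \<noteq> i" by blast
    then show ?thesis
    proof cases
      case 1
      then have "w @ [x] = w @ i # []" by simp
      moreover have "scan_word i (w @ [x]) Unseen = Seen False False"
        using Seen 1 by (simp add: scan_step_def)
      ultimately show ?thesis by fastforce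
    next
      case 2
      have "\<exists>!q. adj i q \<and> q \<in> set v" using 2 w ex1_adj_iff[of i "set v"] by blast
      moreover have "w @ [x] = u @ i # v @ i # []" using 2 w by simp
      ultimately have "\<not> good (w @ [x])" using w(2) unfolding good_def by blast
      moreover have "scan_word i (w @ [x]) Unseen = Bad" using Seen 2 by (simp add: scan_step_def)
      ultimately show ?thesis by simp
    next
      case 3
      have *: "w @ [x] = u @ i # (v @ [x])" "i \<notin> set (v @ [x])" using 3 w by auto
      have "scan_word i (w @ [x]) Unseen =
        Seen (\<exists>z. Suc z = i \<and> z \<in> set (v @ [x])) (Suc i \<in> set (v @ [x]))"
        using Seen 3 w by (auto simp: scan_step_def)
      then show ?thesis
        using * by (intro conjI allI impI exI[of _ u] exI[of _ "v @ [x]"]) simp_all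
    qed
  next
    case Bad
    then have "\<not> good w" using snoc by blast
    then have "\<not> good (w @ [x])" using good_factor[of "[]" w "[x]"] by auto
    moreover have "scan_word i (w @ [x]) Unseen = Bad" using Bad by (simp add: scan_step_def)
    ultimately show ?thesis by simp
  qed
qed simp

lemma good_iff_scan: "good w \<longleftrightarrow> (\<forall>i. scan_word i w Unseen \<noteq> Bad)"
proof
  assume "good w"
  then show "\<forall>i. scan_word i w Unseen \<noteq> Bad" using scan_word_cases by blast
next
  assume n: "\<forall>i. scan_word i w Unseen \<noteq> Bad"
  show "good w"
    unfolding good_def
  proof (intro allI impI notI)
    fix u v t i
    assume w: "w = u @ i # v @ i # t" and i: "i \<notin> set v" and ex: "\<exists>!q. adj i q \<and> q \<in> set v"
    have "scan_word i w Unseen = Bad"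
    \<comment> \<open>Reading \<open>i\<close> either ends in \<open>Bad\<close>, which persists, or
      resets both bits, so the prefix \<open>u\<close> cannot mask the bad factor.\<close>
    proof (cases "scan_step i i (scan_word i u Unseen) = Bad")
      case True
      then show ?thesis using w by (simp add: scan_step_def)
    next
      case False
      then have "scan_step i i (scan_word i u Unseen) = Seen False False"
        using scan_step_self by blast
      moreover have "(\<exists>z. Suc z = i \<and> z \<in> set v) \<noteq> (Suc i \<in> set v)"
        using ex unfolding ex1_adj_iff .
      ultimately have "scan_step i i (scan_word i v (scan_step i i (scan_word i u Unseen))) = Bad"
        using i by (simp add: scan_word_Seen) (simp add: scan_step_def)
      then show ?thesis using w by simp
    qed
    then show False using n by blast
  qed
qed

lemma scan_comm:
  "p + 1 < q \<or> q + 1 < p \<Longrightarrow> scan_step i q (scan_step i p s) = scan_step i p (scan_step i q s)"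
  by (auto simp: scan_step_def split: scan.splits)

lemma scan_idem: "scan_step i p (scan_step i p s) = scan_step i p s"
  by (auto simp: scan_step_def split: scan.splits)

lemma not_good_braid: "adj p q \<Longrightarrow> \<not> good (u @ [p, q, p] @ v)"
  using goodD[of u p "[q]" v] by (auto simp: adj_def)

lemma adj_sym: "adj p q \<longleftrightarrow> adj q p"
  by (auto simp: adj_def)

text \<open>The braid rule covers all \<open>p\<close> and \<open>q\<close>: for adjacent letters
  both sides contain a bad factor, for commuting letters both sides scan like \<open>[p, q]\<close>,
  and for equal letters they coincide.\<close>

lemma good_hecke_step: "hecke_step u v \<Longrightarrow> good u \<longleftrightarrow> good v"
proof (induction rule: hecke_step.induct)
  case (comm p q u v)
  then show ?case by (simp add: good_iff_scan scan_comm[of p q])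
next
  case (braid u p q v)
  show ?case
  proof (cases "adj p q")
    case True
    then show ?thesis using not_good_braid adj_sym by blast
  next
    case False
    then consider "p = q" | "p + 1 < q \<or> q + 1 < p" unfolding adj_def by linarith
    then show ?thesis
    proof cases
      case 2
      then show ?thesis by (auto simp: good_iff_scan scan_comm[of p q] scan_idem)
    qed simp
  qed
next
  case (idem u p v)
  show ?case by (simp add: good_iff_scan scan_idem)
qed

lemma good_hecke_equiv: "hecke_equiv u v \<Longrightarrow> good u \<longleftrightarrow> good v"
  unfolding hecke_equiv_def
  by (induction rule: equivclp_induct) (use good_hecke_step in blast)+

section \<open>Hecke equivalence as a congruence, and commuting a letter through a word\<close>

lemma hecke_equiv_refl [simp, intro]: "hecke_equiv u u"
  by (simp add: hecke_equiv_def)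

lemma hecke_equiv_sym: "hecke_equiv u v \<Longrightarrow> hecke_equiv v u"
  unfolding hecke_equiv_def by (rule equivclp_sym)

lemma hecke_equiv_trans [trans]: "hecke_equiv u v \<Longrightarrow> hecke_equiv v w \<Longrightarrow> hecke_equiv u w"
  unfolding hecke_equiv_def by (rule equivclp_trans)

lemma hecke_equiv_step: "hecke_step u v \<Longrightarrow> hecke_equiv u v"
  unfolding hecke_equiv_def by (rule r_into_equivclp)

lemma hecke_step_context: "hecke_step u v \<Longrightarrow> hecke_step (a @ u @ b) (a @ v @ b)"
proof (induction rule: hecke_step.induct)
  case (comm p q u v)
  then show ?case using hecke_step.comm[of p q "a @ u" "v @ b"] by simp
next
  case (braid u p q v)
  then show ?case using hecke_step.braid[of "a @ u" p q "v @ b"] by simp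
next
  case (idem u p v)
  then show ?case using hecke_step.idem[of "a @ u" p "v @ b"] by simp
qed

lemma hecke_equiv_context: "hecke_equiv u v \<Longrightarrow> hecke_equiv (a @ u @ b) (a @ v @ b)"
  unfolding hecke_equiv_def
proof (induction rule: equivclp_induct)
  case (step y z)
  then have "hecke_step (a @ y @ b) (a @ z @ b) \<or> hecke_step (a @ z @ b) (a @ y @ b)"
    using hecke_step_context by blast
  then show ?case using step.IH by (meson equivclp_into_equivclp)
qed simp

lemma hecke_equiv_append:
  assumes "hecke_equiv a b" "hecke_equiv c d" shows "hecke_equiv (a @ c) (b @ d)"
  using hecke_equiv_context[OF assms(1), of "[]" c] hecke_equiv_context[OF assms(2), of b "[]"]
  by (auto intro: hecke_equiv_trans)

lemma hecke_equiv_comm: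
  "(\<And>z. z \<in> set v \<Longrightarrow> z \<noteq> i \<and> \<not> adj i z) \<Longrightarrow> hecke_equiv (i # v) (v @ [i])"
proof (induction v)
  case (Cons z v)
  have "z \<noteq> i" "\<not> adj i z" using Cons.prems[of z] by auto
  then have "i + 1 < z \<or> z + 1 < i" unfolding adj_def by linarith
  then have "hecke_equiv ([i, z] @ v) ([z, i] @ v)"
    using hecke_step.comm[of i z "[]" v] hecke_equiv_step by fastforce
  moreover have "hecke_equiv (i # v) (v @ [i])" using Cons by simp
  ultimately show ?case
    using hecke_equiv_context[of "i # v" "v @ [i]" "[z]" "[]"] by (auto intro: hecke_equiv_trans)
qed simp

lemma hecke_equiv_idem: "hecke_equiv [i, i] [i]"
  using hecke_step.idem[of "[]" i "[]"] hecke_equiv_step by fastforce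

lemma hecke_equiv_absorb:
  assumes "\<And>z. z \<in> set v \<Longrightarrow> z \<noteq> i \<and> \<not> adj i z"
  shows "hecke_equiv (i # v @ [i]) (i # v)" "hecke_equiv (i # v @ [i]) (v @ [i])"
proof -
  have c: "hecke_equiv (i # v) (v @ [i])" using assms by (rule hecke_equiv_comm)
  have "hecke_equiv (i # v @ [i]) (v @ [i, i])"
    using hecke_equiv_append[OF c hecke_equiv_refl[of "[i]"]] by simp
  also have "hecke_equiv (v @ [i, i]) (v @ [i])"
    by (intro hecke_equiv_append hecke_equiv_idem hecke_equiv_refl)
  finally show *: "hecke_equiv (i # v @ [i]) (v @ [i])" .
  show "hecke_equiv (i # v @ [i]) (i # v)"
    using * c hecke_equiv_sym hecke_equiv_trans by blast
qed

section \<open>Reduced words\<close>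

lemma hecke_reduced_equiv:
  "hecke_reduced r \<Longrightarrow> hecke_equiv v r \<Longrightarrow> length v = length r \<Longrightarrow> hecke_reduced v"
  unfolding hecke_reduced_def by (metis hecke_equiv_trans)

text \<open>With no neighbour in between, one \<open>i\<close> commutes through \<open>v\<close> and
  merges with the other, which gives an equivalent shorter word.\<close>

lemma reduced_no_short_factor:
  assumes r: "hecke_reduced (u @ i # v @ i # t)" and i: "i \<notin> set v"
  shows "\<exists>q \<in> set v. adj i q"
proof (rule ccontr)
  assume "\<not> ?thesis"
  then have "hecke_equiv (i # v @ [i]) (i # v)" using i hecke_equiv_absorb by metis
  from hecke_equiv_context[OF this, of u t]
  have "hecke_equiv (u @ i # v @ t) (u @ i # v @ i # t)" using hecke_equiv_sym by simp
  then show False using r unfolding hecke_reduced_def by fastforce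
qed

text \<open>In a shortest bad factor the unique neighbour \<open>q\<close> cannot repeat, since the two copies
  would merge; hence commutations expose a braid.\<close>

lemma reduced_fully_commutative_factor:
  assumes fc: "fully_commutative r" and red: "hecke_reduced r"
  shows "r = u @ i # v @ i # t \<Longrightarrow> i \<notin> set v \<Longrightarrow> \<not> (\<exists>!q. adj i q \<and> q \<in> set v)"
proof (induction "length v" arbitrary: u i v t rule: less_induct)
  case less
  show ?case
  proof
    assume "\<exists>!q. adj i q \<and> q \<in> set v"
    then obtain q where q: "adj i q" "q \<in> set v" and uq: "\<And>z. adj i z \<Longrightarrow> z \<in> set v \<Longrightarrow> z = q"
      by blast
    obtain a b where v: "v = a @ q # b" and qa: "q \<notin> set a" using split_list_first[OF q(2)] by blast
    show False
    proof (cases "q \<in> set b")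
      case True
      obtain c d where b: "b = c @ q # d" and qc: "q \<notin> set c" using split_list_first[OF True] by blast
      have r: "r = (u @ i # a) @ q # c @ q # (d @ i # t)" using less.prems v b by simp
      have "length c < length v" using v b by simp
      then have n: "\<not> (\<exists>!z. adj q z \<and> z \<in> set c)" using less.hyps r qc by blast
      obtain z where z: "z \<in> set c" "adj q z"
        using reduced_no_short_factor[of "u @ i # a" q c "d @ i # t"] red r qc by auto
      \<comment> \<open>The letter \<open>i\<close> is one of the two neighbours of
        \<open>q\<close>, so its absence from \<open>c\<close> leaves room for at most one;
        reducedness supplies that one, and \<open>c\<close> becomes a shorter bad factor.\<close>
      have "i \<notin> set c" using less.prems(2) v b by simp
      then have "z' = z" if "adj q z'" "z' \<in> set c" for z'
        using that z q(1) unfolding adj_def by (metis Suc_inject)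
      then show False using n z by blast
    next
      case False
      have com: "z \<noteq> i \<and> \<not> adj i z" if "z \<in> set a \<or> z \<in> set b" for z
        using that less.prems(2) uq[of z] v qa False by auto
      have A: "hecke_equiv (i # a) (a @ [i])" and B: "hecke_equiv (i # b) (b @ [i])"
        using com hecke_equiv_comm by blast+
      have "hecke_equiv ((i # a) @ [q] @ (b @ [i])) ((a @ [i]) @ [q] @ (i # b))"
        by (intro hecke_equiv_append A hecke_equiv_sym[OF B] hecke_equiv_refl)
      from hecke_equiv_context[OF this, of u t]
      have e: "hecke_equiv (u @ a @ [i, q, i] @ b @ t) r"
        using less.prems v hecke_equiv_sym by simp
      moreover have "hecke_reduced (u @ a @ [i, q, i] @ b @ t)"
        using hecke_reduced_equiv[OF red e] less.prems v by simp
      moreover have "sublist [i, q, i] (u @ a @ [i, q, i] @ b @ t)"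
        unfolding sublist_def by (metis append.assoc)
      ultimately show False using fc q(1) unfolding fully_commutative_def adj_def by auto
    qed
  qed
qed

lemma fully_commutative_equiv:
  "hecke_equiv u v \<Longrightarrow> fully_commutative u \<Longrightarrow> fully_commutative v"
  unfolding fully_commutative_def by (meson hecke_equiv_sym hecke_equiv_trans)

lemma ex_hecke_reduced: "\<exists>r. hecke_equiv r w \<and> hecke_reduced r"
proof -
  have "hecke_equiv w w" by simp
  then obtain r where "hecke_equiv r w" "\<forall>v. hecke_equiv v w \<longrightarrow> length r \<le> length v"
    using ex_has_least_nat[of "\<lambda>v. hecke_equiv v w" w length] by blast
  then show ?thesis unfolding hecke_reduced_def by (meson hecke_equiv_trans)
qed

text \<open>Forwards, goodness is established on a reduced representative and carried back by
  invariance. Backwards, a braid is itself a bad factor, so it can occur in no word equivalent to a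
  good one.\<close>

lemma fully_commutative_iff_good: "fully_commutative w \<longleftrightarrow> good w"
proof
  assume fc: "fully_commutative w"
  obtain r where r: "hecke_equiv r w" "hecke_reduced r" using ex_hecke_reduced by blast
  have "fully_commutative r" using fc r(1) fully_commutative_equiv hecke_equiv_sym by blast
  then have "good r" using reduced_fully_commutative_factor r(2) unfolding good_def by blast
  then show "good w" using good_hecke_equiv r(1) by blast
next
  assume g: "good w"
  have "\<not> sublist [p, q, p] v" if "hecke_equiv v w" "adj p q" for v p q
    using that g good_hecke_equiv not_good_braid unfolding sublist_def by metis
  then show "fully_commutative w" unfolding fully_commutative_def adj_def by auto
qed

section \<open>Inserting into a single row\<close>

text \<open>Cases 2 and 3 in one function. When \<open>x\<close> exceeds the whole row this is
  \<open>Min {}\<close> and carries no information.\<close>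

definition row_bump :: "nat \<Rightarrow> nat list \<Rightarrow> nat" where
  "row_bump x R = (if x \<notin> set R then Min {z \<in> set R. z > x}
     else Min {z \<in> set R. z \<le> x \<and> {z..x} \<subseteq> set R})"

definition row_insert :: "nat \<Rightarrow> nat list \<Rightarrow> nat list" where
  "row_insert x R = (if \<forall>z\<in>set R. z < x then R @ [x]
     else if x \<notin> set R then map (\<lambda>z. if z = row_bump x R then x else z) R else R)"

text \<open>The bounded quantifier merges the empty row with the test against \<open>Max\<close>,
  which is unspecified on the empty set.\<close>

lemma star_insert_letter_Cons:
  "star_insert_letter x (R # P) = (if \<forall>z\<in>set R. z < x then (row_insert x R # P, 0)
     else (let (P', r) = star_insert_letter (row_bump x R) P in (row_insert x R # P', Suc r)))"
proof -
  have "(R = [] \<or> Max (set R) < x) \<longleftrightarrow> (\<forall>z\<in>set R. z < x)"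
    by (cases "R = []") (simp_all add: Max_less_iff)
  then show ?thesis by (simp add: row_insert_def row_bump_def Let_def)
qed

lemma row_bump_greater:
  assumes "\<not> (\<forall>z\<in>set R. z < x)" "x \<notin> set R"
  shows "row_bump x R \<in> set R" "x < row_bump x R" "\<And>z. z \<in> set R \<Longrightarrow> x < z \<Longrightarrow> row_bump x R \<le> z"
proof -
  have ne: "{z \<in> set R. z > x} \<noteq> {}"
    using assms by (metis (mono_tags, lifting) empty_iff linorder_neqE_nat mem_Collect_eq)
  then have "Min {z \<in> set R. z > x} \<in> {z \<in> set R. z > x}" by (intro Min_in) auto
  then show "row_bump x R \<in> set R" "x < row_bump x R" using assms by (auto simp: row_bump_def)
  show "row_bump x R \<le> z" if "z \<in> set R" "x < z" for z
    using that assms by (auto simp: row_bump_def)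
qed

text \<open>The last clause is the one that drives absorption from the left: a predecessor of the
  bumped letter in \<open>R\<close> would extend the run downwards, against minimality.\<close>

lemma row_bump_run:
  assumes "x \<in> set R"
  shows "row_bump x R \<in> set R" "row_bump x R \<le> x" "{row_bump x R..x} \<subseteq> set R"
    "\<And>z. z \<in> set R \<Longrightarrow> z \<le> x \<Longrightarrow> {z..x} \<subseteq> set R \<Longrightarrow> row_bump x R \<le> z"
    "\<And>z. z \<in> set R \<Longrightarrow> Suc z \<noteq> row_bump x R"
proof -
  let ?A = "{z \<in> set R. z \<le> x \<and> {z..x} \<subseteq> set R}"
  have b: "row_bump x R = Min ?A" using assms by (simp add: row_bump_def)
  have "x \<in> ?A" using assms by auto
  then have "Min ?A \<in> ?A" by (intro Min_in) auto
  then show 1: "row_bump x R \<in> set R" "row_bump x R \<le> x" "{row_bump x R..x} \<subseteq> set R"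
    using b by auto
  show 2: "row_bump x R \<le> z" if "z \<in> set R" "z \<le> x" "{z..x} \<subseteq> set R" for z
    using that b by simp
  show "Suc z \<noteq> row_bump x R" if "z \<in> set R" for z
  proof
    assume s: "Suc z = row_bump x R"
    have "{z..x} \<subseteq> insert z {row_bump x R..x}" using s by auto
    then show False using 1 2[of z] that s by auto
  qed
qed

text \<open>Strictness of the row makes the bumped entry occur once, so the \<open>map\<close> in
  Case 2 changes a single position.\<close>

lemma row_insert_replace:
  assumes R: "sorted_wrt (<) R" and n: "\<not> (\<forall>z\<in>set R. z < x)" "x \<notin> set R"
  obtains a y b where "R = a @ y # b" "row_insert x R = a @ x # b"
    "\<forall>z\<in>set a. z < x" "x < y" "\<forall>z\<in>set b. y < z" "row_bump x R = y"
proof -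
  define y where "y = row_bump x R"
  note y = row_bump_greater[OF n, folded y_def]
  obtain a b where ab: "R = a @ y # b" using y(1) by (meson split_list)
  have lt: "\<forall>z\<in>set a. z < y" "\<forall>z\<in>set b. y < z" using R ab by (auto simp: sorted_wrt_append)
  have a: "\<forall>z\<in>set a. z < x"
  proof
    fix z assume z: "z \<in> set a"
    then have "z \<in> set R" using ab by simp
    then show "z < x" using y(3)[of z] lt(1) z n(2) by (metis linorder_neqE_nat not_less)
  qed
  let ?f = "\<lambda>z. if z = y then x else z"
  have "map ?f a = a" using lt(1) by (intro map_idI) auto
  moreover have "map ?f b = b" using lt(2) by (intro map_idI) auto
  ultimately have "map ?f R = a @ x # b" using ab by simp
  then have "row_insert x R = a @ x # b" unfolding row_insert_def y_def if_not_P[OF n(1)] using n(2) by simp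
  then show ?thesis using that ab a y(2) lt(2) y_def by metis
qed

lemma row_insert_absorb: "x \<in> set R \<Longrightarrow> row_insert x R = R"
  by (auto simp: row_insert_def)

lemma sorted_row_insert:
  assumes R: "sorted_wrt (<) R"
  shows "sorted_wrt (<) (row_insert x R)"
proof -
  consider "\<forall>z\<in>set R. z < x" | "x \<in> set R" | "\<not> (\<forall>z\<in>set R. z < x)" "x \<notin> set R" by blast
  then show ?thesis
  proof cases
    case 1
    then show ?thesis using R by (simp add: row_insert_def sorted_wrt_append)
  next
    case 2
    then show ?thesis using R by (simp add: row_insert_absorb)
  next
    case 3
    from R 3 obtain a y b where ab: "R = a @ y # b" "row_insert x R = a @ x # b"
      "\<forall>z\<in>set a. z < x" "x < y" "\<forall>z\<in>set b. y < z"
      by (rule row_insert_replace)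
    have "sorted_wrt (<) (a @ y # b)" using R ab(1) by simp
    then show ?thesis using ab(2-5) by (auto simp: sorted_wrt_append)
  qed
qed

text \<open>After \<open>x\<close> the row continues with larger letters only, so
  \<open>x + 1\<close> would be the sole neighbour between the \<open>x\<close> in the row and the
  appended one.\<close>

lemma good_row_Suc_notin:
  assumes R: "sorted_wrt (<) R" and g: "good (R @ [x])" and x: "x \<in> set R"
  shows "Suc x \<notin> set R"
proof
  assume s: "Suc x \<in> set R"
  obtain a b where ab: "R = a @ x # b" using x by (meson split_list)
  have lt: "\<forall>z\<in>set a. z < x" "\<forall>z\<in>set b. x < z" using R ab by (auto simp: sorted_wrt_append)
  have "Suc x \<in> set b" using s ab lt by auto
  then have "\<exists>!q. adj x q \<and> q \<in> set b" using lt(2) by (auto simp: adj_def)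
  moreover have "x \<notin> set b" using lt(2) by auto
  moreover have "good (a @ x # b @ x # [])" using g ab by simp
  ultimately show False using goodD by blast
qed

text \<open>The letters before \<open>y\<close> in the row are smaller and differ from
  \<open>y - 1\<close>, so the prepended \<open>y\<close> commutes past them and merges.\<close>

lemma row_absorb_left:
  assumes R: "sorted_wrt (<) R" and y: "y \<in> set R" and n: "\<And>z. z \<in> set R \<Longrightarrow> Suc z \<noteq> y"
  shows "hecke_equiv (y # R) R"
proof -
  obtain a b where ab: "R = a @ y # b" using y by (meson split_list)
  have "z \<noteq> y \<and> \<not> adj y z" if "z \<in> set a" for z
    using that R ab n[of z] by (auto simp: sorted_wrt_append adj_def)
  then have "hecke_equiv (y # a @ [y]) (a @ [y])" by (rule hecke_equiv_absorb(2))
  from hecke_equiv_context[OF this, of "[]" b] show ?thesis using ab by simp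
qed

lemma row_absorb_right:
  assumes R: "sorted_wrt (<) R" and x: "x \<in> set R" and n: "Suc x \<notin> set R"
  shows "hecke_equiv (R @ [x]) R"
proof -
  obtain a b where ab: "R = a @ x # b" using x by (meson split_list)
  have "z \<noteq> x \<and> \<not> adj x z" if "z \<in> set b" for z
    using that R ab n by (auto simp: sorted_wrt_append adj_def)
  then have "hecke_equiv (x # b @ [x]) (x # b)" by (rule hecke_equiv_absorb(1))
  from hecke_equiv_context[OF this, of a "[]"] show ?thesis using ab by simp
qed

text \<open>In Case 3, \<open>x\<close> is absorbed on the right and the start of its run is created
  on the left. In Case 2, entries right of the replaced \<open>y\<close> are at least
  \<open>x + 2\<close> and entries left of it are at most \<open>y - 2\<close>, so \<open>x\<close>
  and \<open>y\<close> commute past them.\<close>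

lemma row_insert_hecke_equiv:
  assumes R: "sorted_wrt (<) R" and n: "\<not> (\<forall>z\<in>set R. z < x)" and s: "x \<in> set R \<Longrightarrow> Suc x \<notin> set R"
  shows "hecke_equiv (R @ [x]) (row_bump x R # row_insert x R)"
proof (cases "x \<in> set R")
  case True
  have "hecke_equiv (R @ [x]) R"
    using R True s[OF True] by (rule row_absorb_right)
  also have "hecke_equiv R (row_bump x R # R)"
    using R row_bump_run[OF True] by (intro hecke_equiv_sym[OF row_absorb_left])
  finally show ?thesis using True by (simp add: row_insert_absorb)
next
  case False
  from R n False obtain a y b where ab: "R = a @ y # b" "row_insert x R = a @ x # b"
    "\<forall>z\<in>set a. z < x" "x < y" "\<forall>z\<in>set b. y < z" and y: "row_bump x R = y"
    by (rule row_insert_replace)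
  have "z \<noteq> x \<and> \<not> adj x z" if "z \<in> set b" for z
    using that ab(4,5) by (fastforce simp: adj_def)
  then have B: "hecke_equiv (b @ [x]) (x # b)" by (intro hecke_equiv_sym[OF hecke_equiv_comm])
  have "z \<noteq> y \<and> \<not> adj y z" if "z \<in> set a" for z
    using that ab(3,4) by (fastforce simp: adj_def)
  then have A: "hecke_equiv (a @ [y]) (y # a)" by (intro hecke_equiv_sym[OF hecke_equiv_comm])
  have "hecke_equiv ((a @ [y]) @ (b @ [x])) ((y # a) @ (x # b))"
    by (intro hecke_equiv_append A B)
  then show ?thesis unfolding y ab(2) by (simp add: ab(1))
qed

text \<open>A uniform description of appending and replacing: \<open>j = length R\<close> is the
  append case, where the \<open>drop\<close> is empty.\<close>

lemma row_insert_position: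
  assumes R: "sorted_wrt (<) R" and x: "x \<notin> set R"
  obtains j where "j \<le> length R" "\<forall>k<j. R ! k < x" "row_insert x R = take j R @ x # drop (Suc j) R"
    "j < length R \<Longrightarrow> x < R ! j" "j = length R \<longleftrightarrow> (\<forall>z\<in>set R. z < x)"
    "j < length R \<Longrightarrow> R ! j = row_bump x R"
proof (cases "\<forall>z\<in>set R. z < x")
  case True
  then show ?thesis using that[of "length R"] by (simp add: row_insert_def)
next
  case False
  from R False x obtain a y b where R': "R = a @ y # b" and ab: "row_insert x R = a @ x # b"
    "\<forall>z\<in>set a. z < x" "x < y" and y: "row_bump x R = y" by (rule row_insert_replace)
  show ?thesis
  proof (rule that[of "length a"])
    show "\<forall>k<length a. R ! k < x" using R' ab(2) by (simp add: nth_append)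
    show "row_insert x R = take (length a) R @ x # drop (Suc (length a)) R"
      using R' ab(1) by simp
    show "length a = length R \<longleftrightarrow> (\<forall>z\<in>set R. z < x)" using R' False by auto
    show "x < R ! length a" using R' ab(3) by simp
    show "R ! length a = row_bump x R" using R' y by simp
    show "length a \<le> length R" using R' by simp
  qed
qed

lemma strict_sorted_nth_mono:
  "sorted_wrt (<) R \<Longrightarrow> i \<le> j \<Longrightarrow> j < length R \<Longrightarrow> R ! i \<le> (R ! j :: nat)"
  by (metis le_neq_implies_less less_imp_le order_refl sorted_wrt_nth_less)

text \<open>Column data for the row above: \<open>p\<close> is the old place of the bumped letter,
  and the entry there after insertion (\<open>x\<close> in Case 2, the bumped letter itself in Case
  3) does not exceed that letter.\<close>

lemma row_insert_bump_position:
  assumes R: "sorted_wrt (<) R" and n: "\<not> (\<forall>z\<in>set R. z < x)"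
  obtains p where "p < length R" "R ! p = row_bump x R" "row_insert x R ! p \<le> row_bump x R"
    "length (row_insert x R) = length R" "\<forall>j<length R. row_insert x R ! j \<le> R ! j"
proof (cases "x \<in> set R")
  case True
  then show ?thesis
    using that row_bump_run(1)[OF True] by (auto simp: row_insert_absorb in_set_conv_nth)
next
  case False
  from R n False obtain a y b where R': "R = a @ y # b" and ab: "row_insert x R = a @ x # b"
    "\<forall>z\<in>set a. z < x" "x < y" and y: "row_bump x R = y" by (rule row_insert_replace)
  show ?thesis
  proof (rule that[of "length a"])
    show "\<forall>j<length R. row_insert x R ! j \<le> R ! j"
      unfolding ab(1) using ab(3) by (auto simp: R' nth_append nth_Cons split: nat.splits)
    show "row_insert x R ! length a \<le> row_bump x R" using ab y by simp
    show "R ! length a = row_bump x R" using R' y by simp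
    show "length (row_insert x R) = length R" "length a < length R" using R' ab(1) by simp_all
  qed
qed

section \<open>Column condition\<close>

definition below :: "nat list \<Rightarrow> nat list \<Rightarrow> bool" where
  "below R S \<longleftrightarrow> length S \<le> length R \<and> (\<forall>j<length S. R ! j \<le> S ! j)"

text \<open>The bumped \<open>y\<close> lands at a position \<open>j \<le> p\<close>, because all
  entries of \<open>S\<close> left of \<open>j\<close> are below \<open>y\<close> while
  \<open>S ! p\<close>, if present, is at least \<open>R ! p = y\<close>. Under it stands
  \<open>R' ! j \<le> R' ! p \<le> y\<close>; and \<open>p < length R\<close> keeps the upper row
  from outgrowing the lower one.\<close>

lemma below_row_insert:
  assumes R: "sorted_wrt (<) R" and S: "sorted_wrt (<) S" and b: "below R S"
    and n: "\<not> (\<forall>z\<in>set R. z < x)"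
  shows "below (row_insert x R) (row_insert (row_bump x R) S)"
proof -
  define y where "y = row_bump x R"
  define R' where "R' = row_insert x R"
  from R n obtain p where p: "p < length R" "R ! p = y" "R' ! p \<le> y" "length R' = length R"
    "\<forall>j<length R. R' ! j \<le> R ! j"
    unfolding y_def R'_def by (rule row_insert_bump_position)
  have R's: "sorted_wrt (<) R'" using R R'_def sorted_row_insert by simp
  have old: "R' ! j \<le> S ! j" if "j < length S" for j
    using that b p(5) unfolding below_def by (metis le_trans less_le_trans)
  show ?thesis
  proof (cases "y \<in> set S")
    case True
    then show ?thesis using old b p(4) unfolding below_def
      by (simp add: row_insert_absorb flip: y_def R'_def)
  next
    case False
    from S False obtain j where j: "j \<le> length S" "\<forall>k<j. S ! k < y"
      "row_insert y S = take j S @ y # drop (Suc j) S"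
      by (rule row_insert_position)
    have jp: "j \<le> p"
    proof (rule ccontr)
      assume "\<not> j \<le> p"
      then have "S ! p < y" "p < length S" using j by auto
      then show False using b p(2) unfolding below_def by fastforce
    qed
    have "R' ! j \<le> y" using strict_sorted_nth_mono[OF R's jp] p by simp
    moreover have "length (row_insert y S) = (if j < length S then length S else Suc (length S))"
      using j by auto
    moreover have "row_insert y S ! k = (if k = j then y else S ! k)" if "k < length (row_insert y S)" for k
    proof -
      have "take j S @ y # drop (Suc j) S = (if j < length S then S[j := y] else S @ [y])"
        using j(1) by (simp add: upd_conv_take_nth_drop)
      then show ?thesis using that j(1,3) by (auto simp: nth_append)
    qed
    ultimately show ?thesis
      unfolding below_def y_def[symmetric] R'_def[symmetric]
      using old jp p(1,4) b j(1) unfolding below_def by (auto split: if_splits)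
  qed
qed

lemma below_append: "below R S \<Longrightarrow> below (R @ [x]) S"
  by (auto simp: below_def nth_append)

section \<open>Pieri property and reversibility of row insertion\<close>

lemma row_bump_in: "\<not> (\<forall>z\<in>set R. z < x) \<Longrightarrow> row_bump x R \<in> set R"
  using row_bump_greater(1) row_bump_run(1) by blast

lemma row_insert_in:
  assumes "sorted_wrt (<) R"
  shows "x \<in> set (row_insert x R)" "set (row_insert x R) \<subseteq> insert x (set R)"
proof -
  have "x \<in> set (row_insert x R) \<and> set (row_insert x R) \<subseteq> insert x (set R)"
  proof (cases "x \<in> set R")
    case True
    then show ?thesis by (auto simp: row_insert_absorb)
  next
    case False
    from assms False obtain j where "row_insert x R = take j R @ x # drop (Suc j) R"
      by (rule row_insert_position)
    then show ?thesis by (auto dest: in_set_takeD in_set_dropD)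
  qed
  then show "x \<in> set (row_insert x R)" "set (row_insert x R) \<subseteq> insert x (set R)" by auto
qed

text \<open>The comparison of two consecutive letters passes to the letters they bump, hence upwards
  row by row. The delicate situation is \<open>x < x'\<close> with \<open>x'\<close> already in the
  row: its run would have to cross a gap to reach too far down, the gap being \<open>x + 1\<close>
  if \<open>x\<close> was present and the replaced letter otherwise.\<close>

lemma row_bump_mono:
  assumes R: "sorted_wrt (<) R" and s: "x \<in> set R \<Longrightarrow> Suc x \<notin> set R"
    and n: "\<not> (\<forall>z\<in>set R. z < x)" and n': "\<not> (\<forall>z\<in>set (row_insert x R). z < x')"
  shows "x < x' \<Longrightarrow> row_bump x R < row_bump x' (row_insert x R)"
    and "x' \<le> x \<Longrightarrow> row_bump x' (row_insert x R) \<le> row_bump x R"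
proof -
  have "(x < x' \<longrightarrow> row_bump x R < row_bump x' (row_insert x R)) \<and>
    (x' \<le> x \<longrightarrow> row_bump x' (row_insert x R) \<le> row_bump x R)"
  proof (cases "x \<in> set R")
    case True
    note y = row_bump_run[OF True]
    show ?thesis
    proof (cases "x' \<in> set R")
      case x': True
      note y' = row_bump_run[OF x']
      have "row_bump x R < row_bump x' R" if "x < x'"
      proof (rule ccontr)
        assume "\<not> ?thesis"
        then have "Suc x \<in> {row_bump x' R..x'}" using y(2) that by auto
        then show False using y'(3) s[OF True] by blast
      qed
      moreover have "row_bump x' R \<le> row_bump x R" if "x' \<le> x"
      proof (cases "row_bump x R \<le> x'")
        case le: True
        have "{row_bump x R..x'} \<subseteq> set R" using y(3) that by auto
        then show ?thesis using y'(4) y(1) le by blast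
      next
        case False
        then show ?thesis using y'(2) by simp
      qed
      ultimately show ?thesis using True by (simp add: row_insert_absorb)
    next
      case x': False
      have n2: "\<not> (\<forall>z\<in>set R. z < x')" using n' True by (simp add: row_insert_absorb)
      note y' = row_bump_greater[OF n2 x']
      have "row_bump x' R \<le> row_bump x R" if "x' \<le> x"
      proof -
        have "x' \<notin> {row_bump x R..x}" using y(3) x' by blast
        then have "x' < row_bump x R" using that by auto
        then show ?thesis using y'(3) y(1) by blast
      qed
      moreover have "row_bump x R < row_bump x' R" if "x < x'" using that y(2) y'(2) by simp
      ultimately show ?thesis using True by (simp add: row_insert_absorb)
    qed
  next
    case False
    from R n False obtain a y b where ab: "R = a @ y # b" "row_insert x R = a @ x # b"
      "\<forall>z\<in>set a. z < x" "x < y" "\<forall>z\<in>set b. y < z" and y: "row_bump x R = y"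
      by (rule row_insert_replace)
    define R' where "R' = row_insert x R"
    have R': "R' = a @ x # b" using ab(2) R'_def by simp
    have yR': "y \<notin> set R'" using R' ab by auto
    have n2: "\<not> (\<forall>z\<in>set R'. z < x')" using n' R'_def by simp
    show ?thesis
    proof (cases "x' \<in> set R'")
      case x': True
      note y' = row_bump_run[OF x']
      have "y < row_bump x' R'" if "x < x'"
      proof (rule ccontr)
        assume "\<not> ?thesis"
        moreover have "y < x'" using x' that R' ab by auto
        ultimately have "y \<in> {row_bump x' R'..x'}" by auto
        then show False using y'(3) yR' by blast
      qed
      then show ?thesis using y'(2) ab(4) y R'_def by auto
    next
      case x': False
      note y' = row_bump_greater[OF n2 x']
      have "y < row_bump x' R'" if "x < x'"
        using y'(1,2) that R' ab(3,5) by auto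
      moreover have "row_bump x' R' \<le> y" if "x' \<le> x"
      proof -
        have "x \<in> set R'" using R' by simp
        then have "x' < x" using x' that by (metis le_neq_implies_less)
        then show ?thesis using y'(3)[OF \<open>x \<in> set R'\<close>] ab(4) by simp
      qed
      ultimately show ?thesis using y R'_def by auto
    qed
  qed
  then show "x < x' \<Longrightarrow> row_bump x R < row_bump x' (row_insert x R)"
    and "x' \<le> x \<Longrightarrow> row_bump x' (row_insert x R) \<le> row_bump x R" by auto
qed

text \<open>The output alone reveals the case: Case 3 keeps the bumped letter in the row, Case 2
  removes its only copy.\<close>

lemma row_bump_in_row_insert_iff:
  assumes R: "sorted_wrt (<) R" and n: "\<not> (\<forall>z\<in>set R. z < x)"
  shows "row_bump x R \<in> set (row_insert x R) \<longleftrightarrow> x \<in> set R"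
proof (cases "x \<in> set R")
  case True
  then show ?thesis using row_bump_run(1) by (simp add: row_insert_absorb)
next
  case False
  from R n False obtain a y b where "R = a @ y # b" "row_insert x R = a @ x # b"
      "\<forall>z\<in>set a. z < x" "x < y" "\<forall>z\<in>set b. y < z" "row_bump x R = y"
    by (rule row_insert_replace)
  then show ?thesis using False by auto
qed

text \<open>In Case 3 the inserted letter is the upper end of the run starting at the bumped letter,
  since its successor is missing. In Case 2 it is the largest entry of the new row below the bumped
  letter.\<close>

lemma row_insert_inj:
  assumes R: "sorted_wrt (<) R" "sorted_wrt (<) S"
    and s: "x \<in> set R \<Longrightarrow> Suc x \<notin> set R" "y \<in> set S \<Longrightarrow> Suc y \<notin> set S"
    and n: "\<not> (\<forall>z\<in>set R. z < x)" "\<not> (\<forall>z\<in>set S. z < y)"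
    and e: "row_insert x R = row_insert y S" "row_bump x R = row_bump y S"
  shows "R = S \<and> x = y"
proof (cases "x \<in> set R")
  case True
  then have y: "y \<in> set S" using e row_bump_in_row_insert_iff R n by metis
  have RS: "R = S" using e True y by (simp add: row_insert_absorb)
  have "\<not> x < y"
  proof
    assume "x < y"
    then have "Suc x \<in> {row_bump y S..y}" using row_bump_run(2)[OF True] e(2) by auto
    then show False using row_bump_run(3)[OF y] s(1)[OF True] RS by blast
  qed
  moreover have "\<not> y < x"
  proof
    assume "y < x"
    then have "Suc y \<in> {row_bump x R..x}" using row_bump_run(2)[OF y] e(2) by auto
    then show False using row_bump_run(3)[OF True] s(2)[OF y] RS by blast
  qed
  ultimately show ?thesis using RS by simp
next
  case False
  then have y: "y \<notin> set S" using e row_bump_in_row_insert_iff R n by metis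
  from R(1) n(1) False obtain a z b where ab: "R = a @ z # b" "row_insert x R = a @ x # b"
      "\<forall>w\<in>set a. w < x" "x < z" "\<forall>w\<in>set b. z < w" and z: "row_bump x R = z"
    by (rule row_insert_replace)
  from R(2) n(2) y obtain c z' d where cd: "S = c @ z' # d" "row_insert y S = c @ y # d"
      "\<forall>w\<in>set c. w < y" "y < z'" "\<forall>w\<in>set d. z' < w" and z': "row_bump y S = z'"
    by (rule row_insert_replace)
  have zz: "z' = z" using z z' e by simp
  have eq: "a @ x # b = c @ y # d" using ab(2) cd(2) e(1) by simp
  have "x \<in> set (c @ y # d)" unfolding eq[symmetric] by simp
  moreover have "y \<in> set (a @ x # b)" unfolding eq by simp
  \<comment> \<open>An \<open>x\<close> in \<open>d\<close> would exceed \<open>z\<close>, so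
    \<open>x \<le> y\<close>; symmetrically \<open>y \<le> x\<close>.\<close>
  ultimately have xy: "x = y" using ab(3-5) cd(3-5) zz by fastforce
  moreover have "x \<notin> set a" "x \<notin> set b" "x \<notin> set c" using ab cd xy by auto
  ultimately have "a = c" "b = d" using eq by (auto simp: append_Cons_eq_iff)
  then show ?thesis using ab cd zz xy by simp
qed

text \<open>Undoing a row step from the letter \<open>y\<close> returned by the row above. The entry
  \<open>R' ! p \<le> y\<close> guarantees that a letter to eject exists, and the closing clauses
  bound how far the restored row rises, for the column condition.\<close>

lemma row_insert_surj:
  assumes R': "sorted_wrt (<) R'" and g: "good (y # R')" and p: "p < length R'" "R' ! p \<le> y"
  obtains R x q where "sorted_wrt (<) R" "x \<in> set R \<longrightarrow> Suc x \<notin> set R" "\<not> (\<forall>z\<in>set R. z < x)"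
    "row_insert x R = R'" "row_bump x R = y" "length R = length R'" "set R \<subseteq> insert y (set R')"
    "q < length R'" "R' ! q = x" "x \<le> R ! q"
    "\<forall>j<length R'. R' ! j \<le> R ! j" "\<forall>j<length R'. R ! j = R' ! j \<or> p \<le> j \<and> R ! j \<le> y"
proof (cases "y \<in> set R'")
  case True
  obtain a b where ab: "R' = a @ y # b" using True by (meson split_list)
  have lt: "\<forall>z\<in>set a. z < y" using R' ab by (auto simp: sorted_wrt_append)
  have pred: "Suc z \<noteq> y" if z: "z \<in> set R'" for z
  proof
    assume sz: "Suc z = y"
    have za: "z \<in> set a" using z sz R' ab by (auto simp: sorted_wrt_append)
    have "\<exists>!w. adj y w \<and> w \<in> set a"
    proof (rule ex1I[of _ z])
      show "adj y z \<and> z \<in> set a" using sz za by (simp add: adj_def)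
      show "w = z" if "adj y w \<and> w \<in> set a" for w using that lt sz by (auto simp: adj_def)
    qed
    moreover have "good ([] @ y # a @ y # b)" using g ab by simp
    moreover have "y \<notin> set a" using lt by auto
    ultimately show False using goodD by blast
  qed
  let ?A = "{z \<in> set R'. y \<le> z \<and> {y..z} \<subseteq> set R'}"
  \<comment> \<open>Case 3 backwards: the ejected letter is the top of the maximal run that starts
    at \<open>y\<close>.\<close>
  define x where "x = Max ?A"
  have yA: "y \<in> ?A" using True by auto
  then have "Max ?A \<in> ?A" by (intro Max_in) auto
  then have x: "x \<in> set R'" "y \<le> x" "{y..x} \<subseteq> set R'" unfolding x_def by blast+
  have sx: "Suc x \<notin> set R'"
  proof
    assume "Suc x \<in> set R'"
    moreover have "{y..Suc x} \<subseteq> insert (Suc x) {y..x}" by auto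
    ultimately have "Suc x \<in> ?A" using x by auto
    then have "Suc x \<le> x" unfolding x_def by (intro Max_ge) auto
    then show False by simp
  qed
  note bx = row_bump_run[OF x(1)]
  have "row_bump x R' = y"
  proof (rule ccontr)
    assume "row_bump x R' \<noteq> y"
    then have "row_bump x R' < y" using bx(4)[OF True x(2,3)] by simp
    \<comment> \<open>The subtraction is genuine because \<open>row_bump x R' < y\<close>; a run
      starting below \<open>y\<close> would contain the excluded predecessor.\<close>
    then have "y - 1 \<in> {row_bump x R'..x}" "Suc (y - 1) = y" using x(2) by auto
    then show False using bx(3) pred by blast
  qed
  moreover obtain q where "q < length R'" "R' ! q = x" using x(1) by (auto simp: in_set_conv_nth)
  ultimately show ?thesis
    using that[of R' x q] x R' sx row_insert_absorb[OF x(1)] by auto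
next
  case False
  let ?A = "{z \<in> set R'. z < y}"
  define x where "x = Max ?A"
  have "R' ! p \<in> ?A" using p False by (metis (mono_tags, lifting) le_neq_implies_less mem_Collect_eq nth_mem)
  then have "Max ?A \<in> ?A" by (intro Max_in) auto
  then have x: "x \<in> set R'" "x < y" unfolding x_def by blast+
  have xm: "z \<le> x" if "z \<in> set R'" "z < y" for z unfolding x_def using that by (intro Max_ge) auto
  obtain a b where ab: "R' = a @ x # b" using x(1) by (meson split_list)
  have lt: "\<forall>z\<in>set a. z < x" "\<forall>z\<in>set b. x < z" using R' ab by (auto simp: sorted_wrt_append)
  have b: "\<forall>z\<in>set b. y < z"
  proof
    fix z assume "z \<in> set b"
    then show "y < z" using lt(2) xm[of z] False ab by (metis Un_iff linorder_neqE_nat not_le set_append set_subset_Cons subsetD)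
  qed
  define R where "R = a @ y # b"
  have Rs: "sorted_wrt (<) R" using R' ab R_def b lt x(2) by (auto simp: sorted_wrt_append)
  have nR: "\<not> (\<forall>z\<in>set R. z < x)" "x \<notin> set R" using R_def x(2) lt by auto
  note rb = row_bump_greater[OF nR]
  have "row_bump x R = y" using rb(1,2) rb(3)[of y] R_def x(2) lt(1) b by fastforce
  moreover have "row_insert x R = R'"
  proof -
    from Rs nR obtain c z d where cd: "R = c @ z # d" "row_insert x R = c @ x # d"
      "\<forall>w\<in>set c. w < x" "x < z" "\<forall>w\<in>set d. z < w" and "row_bump x R = z"
      by (rule row_insert_replace)
    then have "z = y" using \<open>row_bump x R = y\<close> by simp
    moreover have "y \<notin> set c" "y \<notin> set d" using cd \<open>z = y\<close> by auto
    moreover have "y \<notin> set a" "y \<notin> set b" using ab False by simp_all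
    ultimately have "a = c" "b = d" using cd(1) R_def by (auto simp: append_Cons_eq_iff)
    then show ?thesis using cd(2) ab by simp
  qed
  \<comment> \<open>The only altered position is \<open>length a\<close>; it is not left of
    \<open>p\<close>, because entries in \<open>b\<close> exceed \<open>y\<close> while
    \<open>R' ! p\<close> does not.\<close>
  moreover have "p \<le> length a"
  proof (rule ccontr)
    assume "\<not> p \<le> length a"
    then have "R' ! p \<in> set b" using ab p(1) by (auto simp: nth_append nth_Cons')
    then show False using b p(2) by auto
  qed
  moreover have "R ! j = (if j = length a then y else R' ! j)" if "j < length R'" for j
    using that ab R_def by (auto simp: nth_append nth_Cons split: nat.splits)
  moreover have "R' ! length a = x" "length R = length R'" "length a < length R'"
    "set R \<subseteq> insert y (set R')" using ab R_def by auto
  ultimately show ?thesis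
    using that[of R x "length a"] Rs nR x(2) by simp
qed

section \<open>Inserting into a tableau\<close>

text \<open>The empty default acts as the row above the topmost one, and \<open>below R []\<close>
  always holds.\<close>

fun bottom_row :: "tableau \<Rightarrow> nat list" where
  "bottom_row [] = []"
| "bottom_row (R # P) = R"

text \<open>A row-by-row form of \<open>transpose_semistandard\<close> that follows the recursion of
  insertion. Comparing neighbouring rows suffices; \<open>tab_length_le\<close> restores the global
  shape condition.\<close>

fun tab :: "tableau \<Rightarrow> bool" where
  "tab [] \<longleftrightarrow> True"
| "tab (R # P) \<longleftrightarrow> R \<noteq> [] \<and> (\<forall>x\<in>set R. 0 < x) \<and> sorted_wrt (<) R \<and> below R (bottom_row P) \<and> tab P"

lemma tab_sorted_bottom_row: "tab P \<Longrightarrow> sorted_wrt (<) (bottom_row P)"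
  by (cases P) auto

lemma tab_length_le: "tab P \<Longrightarrow> R \<in> set P \<Longrightarrow> length R \<le> length (bottom_row P)"
proof (induction P)
  case (Cons S P)
  then show ?case by (cases "R = S") (auto simp: below_def)
qed simp

lemma transpose_semistandard_Cons:
  "transpose_semistandard (R # P) \<longleftrightarrow> R \<noteq> [] \<and> (\<forall>x\<in>set R. 0 < x) \<and> sorted_wrt (<) R \<and>
     (\<forall>S\<in>set P. length S \<le> length R) \<and> below R (bottom_row P) \<and> transpose_semistandard P"
proof -
  have nat: "(\<forall>i. Q i) \<longleftrightarrow> Q 0 \<and> (\<forall>i. Q (Suc i))" for Q :: "nat \<Rightarrow> bool"
    by (metis not0_implies_Suc)
  have "(\<forall>i j. i + 1 < length (R # P) \<and> j < length ((R # P) ! (i + 1)) \<longrightarrow>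
      (R # P) ! i ! j \<le> (R # P) ! (i + 1) ! j) \<longleftrightarrow>
    (\<forall>j. P \<noteq> [] \<and> j < length (bottom_row P) \<longrightarrow> R ! j \<le> bottom_row P ! j) \<and>
    (\<forall>i j. i + 1 < length P \<and> j < length (P ! (i + 1)) \<longrightarrow> P ! i ! j \<le> P ! (i + 1) ! j)"
    by (subst nat) (cases P; auto)
  then show ?thesis
    unfolding transpose_semistandard_def is_tableau_def shape_def below_def
    by (cases P) auto
qed

lemma transpose_semistandard_iff_tab: "transpose_semistandard P \<longleftrightarrow> tab P"
proof (induction P)
  case Nil
  then show ?case by (simp add: transpose_semistandard_def is_tableau_def shape_def)
next
  case (Cons R P)
  have "length S \<le> length R" if "tab P" "below R (bottom_row P)" "S \<in> set P" for S
    using that tab_length_le[of P S] by (auto simp: below_def)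
  then show ?case using Cons by (auto simp: transpose_semistandard_Cons)
qed

lemma row_word_simps [simp]: "row_word [] = []" "row_word (R # P) = row_word P @ R"
  by (simp_all add: row_word_def)

lemma bottom_row_insert: "star_insert_letter x P = (P', r) \<Longrightarrow> bottom_row P' = row_insert x (bottom_row P)"
proof (cases P)
  case (Cons R P0)
  assume "star_insert_letter x P = (P', r)"
  then show ?thesis unfolding Cons star_insert_letter_Cons by (auto split: if_splits prod.splits)
qed (auto simp: row_insert_def)

text \<open>The row word starts at the top, so rewriting \<open>R @ [x]\<close> to
  \<open>y # R'\<close> exposes the prefix \<open>row_word P @ [y]\<close>, which is the insertion
  problem left for the upper rows; it inherits goodness as a factor.\<close>

lemma star_insert_letter_tab:
  assumes "tab P" "0 < x" "good (row_word P @ [x])" "star_insert_letter x P = (P', r)"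
  shows "tab P' \<and> hecke_equiv (row_word P @ [x]) (row_word P')"
  using assms
proof (induction P arbitrary: x P' r)
  case Nil
  then show ?case by (auto simp: below_def)
next
  case (Cons R P)
  have R: "R \<noteq> []" "\<forall>z\<in>set R. 0 < z" "sorted_wrt (<) R" "below R (bottom_row P)" "tab P"
    using Cons.prems(1) by auto
  have gR: "good (R @ [x])" using Cons.prems(3) good_factor[of "row_word P" "R @ [x]" "[]"] by simp
  show ?case
  proof (cases "\<forall>z\<in>set R. z < x")
    case True
    then have "P' = (R @ [x]) # P"
      using Cons.prems(4) by (simp only: star_insert_letter_Cons) (simp add: row_insert_def)
    then show ?thesis using R True Cons.prems(2) by (auto simp: sorted_wrt_append below_append)
  next
    case False
    let ?y = "row_bump x R"
    obtain P0 r0 where P0: "star_insert_letter ?y P = (P0, r0)" by fastforce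
    have P': "P' = row_insert x R # P0"
      using Cons.prems(4) P0 unfolding star_insert_letter_Cons if_not_P[OF False] by simp
    have eq: "hecke_equiv (R @ [x]) (?y # row_insert x R)"
      using R(3) False good_row_Suc_notin[OF R(3) gR] by (rule row_insert_hecke_equiv)
    have eq': "hecke_equiv (row_word P @ R @ [x]) ((row_word P @ [?y]) @ row_insert x R)"
      using hecke_equiv_context[OF eq, of "row_word P" "[]"] by simp
    then have "good ([] @ (row_word P @ [?y]) @ row_insert x R)"
      using Cons.prems(3) good_hecke_equiv by auto
    then have "good (row_word P @ [?y])" by (rule good_factor)
    moreover have "0 < ?y" using R(2) row_bump_in[OF False] by blast
    ultimately have IH: "tab P0" "hecke_equiv (row_word P @ [?y]) (row_word P0)"
      using Cons.IH R(5) P0 by blast+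
    have "below (row_insert x R) (bottom_row P0)"
      using below_row_insert[OF R(3) tab_sorted_bottom_row[OF R(5)] R(4) False] bottom_row_insert[OF P0]
      by simp
    moreover have "row_insert x R \<noteq> []" "\<forall>z\<in>set (row_insert x R). 0 < z"
      using row_insert_in[OF R(3), of x] R(2) Cons.prems(2) by auto
    ultimately have "tab P'" using P' IH sorted_row_insert[OF R(3)] by simp
    moreover have "hecke_equiv (row_word P @ R @ [x]) (row_word P0 @ row_insert x R)"
      using eq' hecke_equiv_append[OF IH(2) hecke_equiv_refl] by (rule hecke_equiv_trans)
    ultimately show ?thesis using P' by simp
  qed
qed

text \<open>If \<open>x\<close> is appended it becomes the row maximum, so \<open>x'\<close> stops
  there iff \<open>x < x'\<close>. If both letters bump, two rewritings move the bumped pair in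
  front of the row and \<open>row_bump_mono\<close> hands the comparison to the upper rows.\<close>

lemma star_insert_letter_pieri:
  assumes "tab P" "good (row_word P @ [x, x'])"
    "star_insert_letter x P = (P1, r)" "star_insert_letter x' P1 = (P2, r')"
  shows "(x < x' \<longrightarrow> r' \<le> r) \<and> (x' \<le> x \<longrightarrow> r < r')"
  using assms
proof (induction P arbitrary: x x' P1 P2 r r')
  case Nil
  then have "P1 = [[x]]" "r = 0" by auto
  then show ?case using Nil.prems(4) unfolding star_insert_letter_Cons \<open>P1 = [[x]]\<close>
    by (auto split: if_splits prod.splits)
next
  case (Cons R P)
  have R: "sorted_wrt (<) R" "tab P" using Cons.prems(1) by auto
  have gR: "good (R @ [x])"
    using Cons.prems(2) good_factor[of "row_word P" "R @ [x]" "[x']"] by simp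
  define R1 where "R1 = row_insert x R"
  have R1: "sorted_wrt (<) R1" "x \<in> set R1" using sorted_row_insert R(1) row_insert_in R1_def by auto
  show ?case
  proof (cases "\<forall>z\<in>set R. z < x")
    case True
    then have P1: "P1 = R1 # P" "r = 0"
      using Cons.prems(3) unfolding star_insert_letter_Cons R1_def by auto
    have "R1 = R @ [x]" using True by (simp add: R1_def row_insert_def)
    then have "(\<forall>z\<in>set R1. z < x') \<longleftrightarrow> x < x'" using True by auto
    then show ?thesis
      using Cons.prems(4) unfolding P1 star_insert_letter_Cons by (auto split: if_splits prod.splits)
  next
    case False
    let ?y = "row_bump x R"
    obtain P0 r0 where P0: "star_insert_letter ?y P = (P0, r0)" by fastforce
    have P1: "P1 = R1 # P0" "r = Suc r0"
      using Cons.prems(3) P0 unfolding star_insert_letter_Cons if_not_P[OF False] R1_def by auto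
    show ?thesis
    proof (cases "\<forall>z\<in>set R1. z < x'")
      case True
      then have "r' = 0" "x < x'"
        using Cons.prems(4) R1(2) unfolding P1 star_insert_letter_Cons by auto
      then show ?thesis by simp
    next
      case n': False
      let ?y' = "row_bump x' R1"
      obtain P3 r3 where P3: "star_insert_letter ?y' P0 = (P3, r3)" by fastforce
      have r': "r' = Suc r3"
        using Cons.prems(4) P3 unfolding P1 star_insert_letter_Cons if_not_P[OF n'] by auto
      have s: "Suc x \<notin> set R" if "x \<in> set R" using good_row_Suc_notin[OF R(1) gR that] .
      have "hecke_equiv (R @ [x]) (?y # R1)"
        unfolding R1_def using R(1) False s by (rule row_insert_hecke_equiv)
      from hecke_equiv_context[OF this, of "row_word P" "[x']"]
      have g1: "good ((row_word P @ [?y]) @ R1 @ [x'])"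
        using Cons.prems(2) good_hecke_equiv by auto
      then have "good (R1 @ [x'])" using good_factor[of "row_word P @ [?y]" "R1 @ [x']" "[]"] by simp
      then have "hecke_equiv (R1 @ [x']) (?y' # row_insert x' R1)"
        using good_row_Suc_notin[OF R1(1)] by (intro row_insert_hecke_equiv R1(1) n')
      from hecke_equiv_context[OF this, of "row_word P @ [?y]" "[]"]
      have "good ([] @ (row_word P @ [?y, ?y']) @ row_insert x' R1)"
        using g1 good_hecke_equiv by auto
      then have "good (row_word P @ [?y, ?y'])" by (rule good_factor)
      then have "(?y < ?y' \<longrightarrow> r3 \<le> r0) \<and> (?y' \<le> ?y \<longrightarrow> r0 < r3)"
        using Cons.IH R(2) P0 P3 by blast
      moreover have "x < x' \<Longrightarrow> ?y < ?y'" "x' \<le> x \<Longrightarrow> ?y' \<le> ?y"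
        using row_bump_mono[OF R(1) s False] n' unfolding R1_def by blast+
      ultimately show ?thesis using P1(2) r' by auto
    qed
  qed
qed

text \<open>The common index \<open>r\<close> synchronises the two recursions: \<open>0\<close>
  means that both append, a successor that both bump, where \<open>row_insert_inj\<close> applies
  once the upper parts agree.\<close>

lemma star_insert_letter_inj:
  assumes "tab P" "tab S" "good (row_word P @ [x])" "good (row_word S @ [y])"
    "star_insert_letter x P = (T, r)" "star_insert_letter y S = (T, r)"
  shows "P = S \<and> x = y"
  using assms
proof (induction P arbitrary: x y S T r)
  case Nil
  then have T: "T = [[x]]" "r = 0" by auto
  show ?case
  proof (cases S)
    case Nil
    then show ?thesis using T \<open>star_insert_letter y S = (T, r)\<close> by simp
  next
    case (Cons R S0)
    then have "bottom_row T = R @ [y]" "R \<noteq> []"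
      using T(2) \<open>star_insert_letter y S = (T, r)\<close> \<open>tab S\<close> unfolding Cons star_insert_letter_Cons
      by (auto simp: row_insert_def split: if_splits prod.splits)
    then show ?thesis using T(1) by simp
  qed
next
  case (Cons R P)
  note C = Cons.prems
  have R: "R \<noteq> []" "sorted_wrt (<) R" "tab P" using C by auto
  have gR: "good (R @ [x])" using C(3) good_factor[of "row_word P" "R @ [x]" "[]"] by simp
  show ?case
  proof (cases S)
    case Nil
    then have "T = [[y]]" "r = 0" using C(6) by auto
    moreover have "bottom_row T = R @ [x]"
      using \<open>r = 0\<close> C(5) unfolding star_insert_letter_Cons
      by (auto simp: row_insert_def split: if_splits prod.splits)
    ultimately show ?thesis using R(1) by simp
  next
    case S: (Cons U S0)
    have U: "sorted_wrt (<) U" "tab S0" using C(2) S by auto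
    have gU: "good (U @ [y])" using C(4) S good_factor[of "row_word S0" "U @ [y]" "[]"] by simp
    show ?thesis
    proof (cases "\<forall>z\<in>set R. z < x")
      case True
      then have r: "r = 0" "T = (R @ [x]) # P"
        using C(5) unfolding star_insert_letter_Cons by (auto simp: row_insert_def)
      have "\<forall>z\<in>set U. z < y"
        using C(6) r(1) unfolding S star_insert_letter_Cons by (auto split: if_splits prod.splits)
      then have "T = (U @ [y]) # S0"
        using C(6) unfolding S star_insert_letter_Cons by (auto simp: row_insert_def)
      then show ?thesis using r S by simp
    next
      case n: False
      obtain P0 r0 where P0: "star_insert_letter (row_bump x R) P = (P0, r0)" by fastforce
      have T: "T = row_insert x R # P0" "r = Suc r0"
        using C(5) P0 unfolding star_insert_letter_Cons if_not_P[OF n] by auto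
      have n': "\<not> (\<forall>z\<in>set U. z < y)"
        using C(6) T(2) unfolding S star_insert_letter_Cons by (auto split: if_splits)
      obtain P3 r3 where P3: "star_insert_letter (row_bump y U) S0 = (P3, r3)" by fastforce
      have T': "T = row_insert y U # P3" "r = Suc r3"
        using C(6) P3 unfolding S star_insert_letter_Cons if_not_P[OF n'] by auto
      have s: "x \<in> set R \<Longrightarrow> Suc x \<notin> set R" "y \<in> set U \<Longrightarrow> Suc y \<notin> set U"
        using good_row_Suc_notin R(2) gR U(1) gU by blast+
      from hecke_equiv_context[OF row_insert_hecke_equiv[OF R(2) n s(1)], of "row_word P" "[]"]
      have "good ([] @ (row_word P @ [row_bump x R]) @ row_insert x R)"
        using C(3) good_hecke_equiv by auto
      then have g1: "good (row_word P @ [row_bump x R])" by (rule good_factor)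
      from hecke_equiv_context[OF row_insert_hecke_equiv[OF U(1) n' s(2)], of "row_word S0" "[]"]
      have "good ([] @ (row_word S0 @ [row_bump y U]) @ row_insert y U)"
        using C(4) S good_hecke_equiv by auto
      then have g2: "good (row_word S0 @ [row_bump y U])" by (rule good_factor)
      have "P0 = P3" "r0 = r3" "row_insert x R = row_insert y U" using T T' by auto
      then have 1: "P = S0 \<and> row_bump x R = row_bump y U"
        using Cons.IH[OF R(3) U(2) g1 g2 P0] P3 by simp
      then have "R = U \<and> x = y"
        using row_insert_inj[OF R(2) U(1) s n n'] \<open>row_insert x R = row_insert y U\<close> by blast
      then show ?thesis using S 1 by simp
    qed
  qed
qed

text \<open>The last three clauses are what the row below needs in order to undo its own step
  without violating the column condition.\<close>

lemma star_insert_letter_surj: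
  assumes "tab T" "good (row_word T)" "r < length T"
    "Suc r < length T \<Longrightarrow> length (T ! Suc r) < length (T ! r)"
  shows "\<exists>P x p. tab P \<and> star_insert_letter x P = (T, r) \<and> 0 < x \<and>
    hecke_equiv (row_word T) (row_word P @ [x]) \<and>
    (p < length (bottom_row T) \<and> bottom_row T ! p = x \<and> (p < length (bottom_row P) \<longrightarrow> x \<le> bottom_row P ! p)) \<and>
    length (bottom_row P) \<le> length (bottom_row T) \<and>
    (\<forall>j<length (bottom_row P). bottom_row T ! j \<le> bottom_row P ! j)"
  using assms
proof (induction T arbitrary: r)
  case Nil
  then show ?case by simp
next
  case (Cons R' T)
  note C = Cons.prems
  have R': "R' \<noteq> []" "\<forall>z\<in>set R'. 0 < z" "sorted_wrt (<) R'" "below R' (bottom_row T)" "tab T"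
    using C(1) by auto
  show ?case
  proof (cases r)
    case 0
    obtain R x where Rx: "R' = R @ [x]" using R'(1) by (metis rev_exhaust)
    have lt: "\<forall>z\<in>set R. z < x" using R'(3) Rx by (simp add: sorted_wrt_append)
    have corner: "length (bottom_row T) \<le> length R" using C(4) 0 Rx by (cases T) auto
    show ?thesis
    proof (cases "R = []")
      case True
      then have "bottom_row T = []" using corner by simp
      then have "T = []" using R'(5) by (cases T) auto
      then show ?thesis using True Rx 0 R'(2)
        by (intro exI[of _ "[]"] exI[of _ x] exI[of _ "0::nat"]) simp
    next
      case False
      have "below R (bottom_row T)" using R'(4) corner Rx by (auto simp: below_def nth_append)
      moreover have "star_insert_letter x (R # T) = (R' # T, r)"
        using lt Rx 0 by (simp only: star_insert_letter_Cons) (simp add: row_insert_def)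
      \<comment> \<open>The witness \<open>length R\<close> is the removed cell; it lies outside
        \<open>bottom_row P\<close>, so the clause comparing entries at \<open>p\<close> is
        vacuous.\<close>
      ultimately show ?thesis using False R' Rx
        by (intro exI[of _ "R # T"] exI[of _ x] exI[of _ "length R"])
          (auto simp: sorted_wrt_append nth_append simp del: star_insert_letter.simps)
    qed
  next
    case (Suc r0)
    have "good ([] @ row_word T @ R')" using C(2) by simp
    then have gT: "good (row_word T)" by (rule good_factor)
    have "r0 < length T" "Suc r0 < length T \<Longrightarrow> length (T ! Suc r0) < length (T ! r0)"
      using C(3,4) Suc by auto
    from Cons.IH[OF R'(5) gT this] obtain P y p where
      P: "tab P" "star_insert_letter y P = (T, r0)" "0 < y" "hecke_equiv (row_word T) (row_word P @ [y])"
        "p < length (bottom_row T)" "bottom_row T ! p = y" "p < length (bottom_row P) \<longrightarrow> y \<le> bottom_row P ! p"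
        "length (bottom_row P) \<le> length (bottom_row T)"
        "\<forall>j<length (bottom_row P). bottom_row T ! j \<le> bottom_row P ! j"
      by blast
    have eq1: "hecke_equiv (row_word T @ R') ((row_word P @ [y]) @ R')"
      by (intro hecke_equiv_append P(4) hecke_equiv_refl)
    then have "good (row_word P @ (y # R') @ [])" using C(2) good_hecke_equiv by simp
    then have gy: "good (y # R')" by (rule good_factor)
    have p: "p < length R'" "R' ! p \<le> y" using P(5,6) R'(4) by (auto simp: below_def)
    from R'(3) gy p obtain R x q where R: "sorted_wrt (<) R" "x \<in> set R \<longrightarrow> Suc x \<notin> set R"
      "\<not> (\<forall>z\<in>set R. z < x)" "row_insert x R = R'" "row_bump x R = y" "length R = length R'"
      "set R \<subseteq> insert y (set R')" and q: "q < length R'" "R' ! q = x" "x \<le> R ! q"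
      and le: "\<forall>j<length R'. R' ! j \<le> R ! j" "\<forall>j<length R'. R ! j = R' ! j \<or> p \<le> j \<and> R ! j \<le> y"
      by (rule row_insert_surj)
    have len: "length (bottom_row T) \<le> length R'" using R'(4) by (simp add: below_def)
    \<comment> \<open>Positions where \<open>R\<close> differs from \<open>R'\<close> lie at or
      right of \<open>p\<close> and hold at most \<open>y\<close>, while the row above is at least
      \<open>y\<close> from \<open>p\<close> onwards.\<close>
    have "R ! j \<le> bottom_row P ! j" if j: "j < length (bottom_row P)" for j
    proof -
      have j': "j < length R'" using j P(8) len by simp
      consider "R ! j = R' ! j" | "p \<le> j" "R ! j \<le> y" using le(2) j' by blast
      then show ?thesis
      proof cases
        case 1
        have "R' ! j \<le> bottom_row T ! j" using R'(4) j P(8) by (simp add: below_def)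
        then show ?thesis using 1 P(9) j by (metis le_trans)
      next
        case 2
        then have "y \<le> bottom_row P ! p" using P(7) j by simp
        also have "\<dots> \<le> bottom_row P ! j"
          using strict_sorted_nth_mono[OF tab_sorted_bottom_row[OF P(1)] 2(1) j] .
        finally show ?thesis using 2(2) by simp
      qed
    qed
    then have "below R (bottom_row P)" using P(8) len R(6) by (simp add: below_def)
    moreover have "R \<noteq> []" "\<forall>z\<in>set R. 0 < z" using R(6,7) R'(1,2) P(3) by auto
    ultimately have "tab (R # P)" using P(1) R(1) by simp
    moreover have "star_insert_letter x (R # P) = (R' # T, r)"
      unfolding star_insert_letter_Cons if_not_P[OF R(3)] using R(4,5) P(2) Suc by simp
    moreover have "0 < x" using q R'(2) by (metis nth_mem)
    moreover have "hecke_equiv (row_word (R' # T)) (row_word (R # P) @ [x])"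
    proof -
      have "hecke_equiv (R @ [x]) (y # R')" using row_insert_hecke_equiv[OF R(1,3)] R(2,4,5) by simp
      from hecke_equiv_sym[OF hecke_equiv_context[OF this, of "row_word P" "[]"]]
      show ?thesis using eq1 hecke_equiv_trans by simp
    qed
    ultimately show ?thesis
      using q le(1) R(6) by (intro exI[of _ "R # P"] exI[of _ x] exI[of _ q]) (simp del: star_insert_letter.simps)
  qed
qed

section \<open>The recording tableau\<close>

definition add_box :: "nat \<Rightarrow> nat list \<Rightarrow> nat list" where
  "add_box r s = (if r < length s then s[r := Suc (s ! r)] else s @ [1])"

lemma shape_simps [simp]: "shape [] = []" "shape (R # P) = length R # shape P"
  "length (shape P) = length P"
  by (simp_all add: shape_def)

lemma star_insert_letter_shape:
  "star_insert_letter x P = (P', r) \<Longrightarrow> r \<le> length P \<and> shape P' = add_box r (shape P)"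
proof (induction P arbitrary: x P' r)
  case Nil
  then show ?case by (auto simp: add_box_def)
next
  case (Cons R P)
  show ?case
  proof (cases "\<forall>z\<in>set R. z < x")
    case True
    then show ?thesis using Cons.prems unfolding star_insert_letter_Cons
      by (auto simp: add_box_def row_insert_def)
  next
    case False
    obtain P0 r0 where P0: "star_insert_letter (row_bump x R) P = (P0, r0)" by fastforce
    have "P' = row_insert x R # P0" "r = Suc r0"
      using Cons.prems P0 unfolding star_insert_letter_Cons if_not_P[OF False] by auto
    moreover have "length (row_insert x R) = length R"
      unfolding row_insert_def if_not_P[OF False] by simp
    ultimately show ?thesis using Cons.IH[OF P0] by (auto simp: add_box_def)
  qed
qed

lemma shape_add_cell: "shape (add_cell r q Q) = add_box r (shape Q)"
  by (auto simp: add_cell_def add_box_def shape_def map_update)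

text \<open>Positive parts remove the one ambiguity: a part \<open>1\<close> in position
  \<open>r\<close> could otherwise come from a new row or from a part \<open>0\<close>.\<close>

lemma add_box_inj:
  assumes "0 \<notin> set s" "0 \<notin> set t" "r \<le> length s" "r \<le> length t" "add_box r s = add_box r t"
  shows "s = t"
proof -
  have len: "length s = length t"
  proof (rule ccontr)
    assume ne: "length s \<noteq> length t"
    have *: "False" if "r < length s" "r = length t" "0 \<notin> set s" "add_box r s = add_box r t"
      for s t :: "nat list"
    proof -
      have "add_box r s ! r = Suc (s ! r)" using that(1) by (simp add: add_box_def)
      moreover have "add_box r t ! r = 1" using that(2) by (simp add: add_box_def)
      ultimately have "s ! r = 0" using that(4) by simp
      then show False using that(1,3) by (metis nth_mem)
    qed
    show False using ne assms *[of s t] *[of t s] by (metis add_box_def le_neq_implies_less length_append_singleton length_list_update)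
  qed
  show ?thesis
  proof (cases "r < length s")
    case True
    then have e: "s[r := Suc (s ! r)] = t[r := Suc (t ! r)]" using assms(5) len by (simp add: add_box_def)
    then have "s ! r = t ! r" using True len by (metis nat.inject nth_list_update_eq)
    then show ?thesis using e by (metis list_update_id list_update_overwrite)
  next
    case False
    then show ?thesis using assms(5) len by (simp add: add_box_def)
  qed
qed

lemma add_cell_inj:
  assumes "length Q = length Q'" "add_cell r k Q = add_cell r k Q'"
  shows "Q = Q'"
proof (cases "r < length Q")
  case True
  then have e: "Q[r := Q ! r @ [k]] = Q'[r := Q' ! r @ [k]]" using assms by (simp add: add_cell_def)
  then have "Q ! r @ [k] = Q' ! r @ [k]" using True assms(1) by (metis nth_list_update_eq)
  then have "Q ! r = Q' ! r" by simp
  then show ?thesis using e by (metis list_update_id list_update_overwrite)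
next
  case False
  then show ?thesis using assms by (simp add: add_cell_def)
qed

definition top_cell :: "nat \<Rightarrow> nat \<Rightarrow> tableau \<Rightarrow> bool" where
  "top_cell k r Q \<longleftrightarrow> r < length Q \<and> last (Q ! r) = k \<and> (\<forall>R\<in>set Q. \<forall>z\<in>set R. z \<le> k) \<and>
     (\<forall>i<r. last (Q ! i) < k)"

lemma top_cell_unique:
  assumes ne: "[] \<notin> set Q" and t: "top_cell k r Q" "top_cell k' r' Q"
  shows "k = k' \<and> r = r'"
proof -
  have "last (Q ! i) \<in> set (Q ! i)" "Q ! i \<in> set Q" if "i < length Q" for i
    using that ne by (metis last_in_set nth_mem)+
  then have "k \<le> k'" "k' \<le> k" using t unfolding top_cell_def by metis+
  moreover from this have "\<not> r < r'" "\<not> r' < r" using t unfolding top_cell_def by auto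
  ultimately show ?thesis by simp
qed

text \<open>The partition shape forces a cell under the new one when \<open>r > 0\<close>, with
  entry at most the end of row \<open>r - 1\<close>, hence below \<open>k\<close>. Nothing lies
  above the new cell, since row \<open>r + 1\<close> is no longer than the old row
  \<open>r\<close>.\<close>

lemma semistandard_add_cell:
  assumes Q: "semistandard Q" and r: "r \<le> length Q" and s: "sorted_wrt (\<ge>) (shape (add_cell r k Q))"
    and k: "0 < k" "\<forall>R\<in>set Q. \<forall>z\<in>set R. z \<le> k" "\<forall>i<r. last (Q ! i) < k"
  shows "semistandard (add_cell r k Q) \<and> top_cell k r (add_cell r k Q)"
proof -
  define Q' where "Q' = add_cell r k Q"
  define S where "S = (if r < length Q then Q ! r else [])"
  have ne: "\<forall>R\<in>set Q. R \<noteq> [] \<and> (\<forall>x\<in>set R. 0 < x)" and srt: "\<forall>R\<in>set Q. sorted R"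
    and col: "\<And>i j. i + 1 < length Q \<Longrightarrow> j < length (Q ! (i + 1)) \<Longrightarrow> Q ! i ! j < Q ! (i + 1) ! j"
    using Q unfolding semistandard_def is_tableau_def by auto
  have len: "length Q' = (if r < length Q then length Q else Suc (length Q))" "r < length Q'"
    unfolding Q'_def add_cell_def using r by auto
  have nth: "Q' ! i = (if i = r then S @ [k] else Q ! i)" if "i < length Q'" for i
    using that r unfolding Q'_def S_def add_cell_def by (auto simp: nth_append split: if_splits)
  have S: "\<forall>z\<in>set S. 0 < z \<and> z \<le> k" "sorted S" unfolding S_def using ne srt k(2) by auto
  have nthr: "i < length Q" if "i < length Q'" "i \<noteq> r" for i using that len r by (auto split: if_splits)
  have rows: "R = S @ [k] \<or> R \<in> set Q" if "R \<in> set Q'" for R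
    using that nth nthr by (metis in_set_conv_nth)
  have "is_tableau Q'" unfolding is_tableau_def using rows S(1) k(1) ne s Q'_def by fastforce
  moreover have "\<forall>R\<in>set Q'. sorted R" using rows S srt by (fastforce simp: sorted_append)
  moreover have "Q' ! i ! j < Q' ! (i + 1) ! j"
    if ij: "i + 1 < length Q'" "j < length (Q' ! (i + 1))" for i j
  proof -
    have "shape Q' ! i \<ge> shape Q' ! (i + 1)"
      using s ij(1) unfolding Q'_def[symmetric] by (intro sorted_wrt_nth_less[of "(\<ge>)"]) auto
    then have le: "length (Q' ! (i + 1)) \<le> length (Q' ! i)" using ij(1) by (simp add: shape_def)
    consider "i + 1 = r" | "i = r" | "i + 1 \<noteq> r" "i \<noteq> r" by blast
    then show ?thesis
    proof cases
      case 1
      have i: "Q' ! i = Q ! i" "Q' ! (i + 1) = S @ [k]" "i < length Q" using 1 nth ij(1) r by auto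
      show ?thesis
      proof (cases "j < length S")
        case True
        then show ?thesis using col[of i j] 1 i by (auto simp: S_def nth_append split: if_splits)
      next
        case False
        then have j: "j = length S" using ij(2) i by simp
        then have jl: "j < length (Q ! i)" using le i by simp
        have "sorted (Q ! i)" using srt i(3) by simp
        then have "Q ! i ! j \<le> last (Q ! i)" using jl
          by (subst last_conv_nth) (auto intro: sorted_nth_mono simp: sorted_iff_nth_mono)
        also have "\<dots> < k" using k(3) 1 by simp
        finally show ?thesis using i j by simp
      qed
    next
      case 2
      have i: "Q' ! i = S @ [k]" "Q' ! (i + 1) = Q ! (i + 1)" "i + 1 < length Q"
        using 2 nth ij(1) nthr[of "i + 1"] by auto
      have Si: "S = Q ! i" using i(3) 2 by (simp add: S_def)
      have "shape Q ! i \<ge> shape Q ! (i + 1)"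
        using Q i(3) unfolding semistandard_def is_tableau_def
        by (intro sorted_wrt_nth_less[of "(\<ge>)"]) auto
      then have "j < length S" using ij(2) i Si by (simp add: shape_def)
      then show ?thesis using col[of i j] i ij(2) Si by (simp add: nth_append)
    next
      case 3
      then show ?thesis using col[of i j] ij nth nthr by auto
    qed
  qed
  ultimately have "semistandard Q'" unfolding semistandard_def by blast
  moreover have "top_cell k r Q'"
    unfolding top_cell_def using len(2) nth k(3) rows S(1) k(2) by fastforce
  ultimately show ?thesis unfolding Q'_def by blast
qed

text \<open>A row ending in the maximal entry is longer than the row above it: with equal lengths,
  column strictness would make the end of the upper row larger than the maximum.\<close>

lemma semistandard_remove_cell:
  assumes Q: "semistandard Q" and ne: "Q \<noteq> []"
  obtains k r Q' where "semistandard Q'" "add_cell r k Q' = Q" "top_cell k r Q" "r \<le> length Q'" "0 < k"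
    "Suc r < length Q \<longrightarrow> length (Q ! Suc r) < length (Q ! r)"
proof -
  have nonempty: "\<forall>R\<in>set Q. R \<noteq> [] \<and> (\<forall>x\<in>set R. 0 < x)" and srt: "\<forall>R\<in>set Q. sorted R"
    and shp: "sorted_wrt (\<ge>) (shape Q)"
    and col: "\<And>i j. i + 1 < length Q \<Longrightarrow> j < length (Q ! (i + 1)) \<Longrightarrow> Q ! i ! j < Q ! (i + 1) ! j"
    using Q unfolding semistandard_def is_tableau_def by auto
  let ?A = "\<Union> (set ` set Q)"
  define k where "k = Max ?A"
  have "?A \<noteq> {}" using ne nonempty by (cases Q) auto
  then have "k \<in> ?A" unfolding k_def by (intro Max_in) auto
  then obtain i where i: "i < length Q" "k \<in> set (Q ! i)" by (metis UN_E in_set_conv_nth)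
  have km: "\<forall>R\<in>set Q. \<forall>z\<in>set R. z \<le> k" unfolding k_def by (intro ballI Max_ge) auto
  have last_in: "last (Q ! i) \<in> set (Q ! i)" "last (Q ! i) \<le> k" "0 < last (Q ! i)" if "i < length Q" for i
  proof -
    show "last (Q ! i) \<in> set (Q ! i)" using that nonempty by simp
    then show "last (Q ! i) \<le> k" "0 < last (Q ! i)" using that nonempty km nth_mem by blast+
  qed
  have "k \<le> last (Q ! i)"
  proof -
    obtain l where l: "l < length (Q ! i)" "Q ! i ! l = k" using i(2) by (auto simp: in_set_conv_nth)
    have "Q ! i ! l \<le> Q ! i ! (length (Q ! i) - 1)"
      using srt i(1) l by (intro sorted_nth_mono) auto
    then show ?thesis using l by (subst last_conv_nth) auto
  qed
  then have ex: "i < length Q \<and> last (Q ! i) = k" using last_in(2) i(1) by (simp add: le_antisym)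
  \<comment> \<open>The least index makes all lower row ends smaller than \<open>k\<close>, as the
    last clause of \<open>top_cell\<close> demands.\<close>
  define r where "r = (LEAST r. r < length Q \<and> last (Q ! r) = k)"
  have r: "r < length Q" "last (Q ! r) = k" unfolding r_def using LeastI[of "\<lambda>r. r < length Q \<and> last (Q ! r) = k" i] ex by blast+
  have low: "last (Q ! j) < k" if "j < r" for j
    using not_less_Least[OF that[unfolded r_def]] last_in(2)[of j] that r(1) by simp
  have top: "top_cell k r Q" unfolding top_cell_def using r km low by blast
  have shp': "length (Q ! Suc j) \<le> length (Q ! j)" if "Suc j < length Q" for j
    using sorted_wrt_nth_less[OF shp, of j "Suc j"] that by (simp add: shape_def)
  have corner: "length (Q ! Suc r) < length (Q ! r)" if l: "Suc r < length Q"
  proof (rule ccontr)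
    assume "\<not> ?thesis"
    then have e: "length (Q ! Suc r) = length (Q ! r)" using shp'[OF l] by simp
    have nn: "Q ! r \<noteq> []" "Q ! Suc r \<noteq> []" using nonempty r(1) l by auto
    have "last (Q ! r) < last (Q ! Suc r)"
      using col[of r "length (Q ! r) - 1"] l e nn by (simp add: last_conv_nth)
    then show False using last_in(2)[OF l] r(2) by simp
  qed
  have Qr: "Q ! r = butlast (Q ! r) @ [k]" using r nonempty by (metis append_butlast_last_id nth_mem)
  show ?thesis
  proof (cases "butlast (Q ! r) = []")
    case True
    then have Qr': "Q ! r = [k]" using Qr by simp
    \<comment> \<open>A row above a row of length one would have to be empty, so row
      \<open>r\<close> is the topmost and disappears altogether.\<close>
    have "\<not> Suc r < length Q" using corner Qr' nonempty by (metis One_nat_def length_0_conv length_Cons less_one list.size(3) nth_mem)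
    then have lr: "length Q = Suc r" using r(1) by simp
    then have Q': "Q = butlast Q @ [[k]]" using Qr' ne by (metis append_butlast_last_id diff_Suc_1 last_conv_nth)
    define Q1 where "Q1 = butlast Q"
    have Q1: "Q = Q1 @ [[k]]" "length Q1 = r" using Q' lr by (auto simp: Q1_def)
    have "semistandard Q1"
      unfolding semistandard_def is_tableau_def
    proof (intro conjI)
      show "sorted_wrt (\<ge>) (shape Q1)" using shp Q1 by (simp add: shape_def sorted_wrt_append)
      show "\<forall>i j. i + 1 < length Q1 \<and> j < length (Q1 ! (i + 1)) \<longrightarrow> Q1 ! i ! j < Q1 ! (i + 1) ! j"
      proof (intro allI impI)
        fix i j assume "i + 1 < length Q1 \<and> j < length (Q1 ! (i + 1))"
        then show "Q1 ! i ! j < Q1 ! (i + 1) ! j"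
          using col[of i j] by (simp add: Q1(1) nth_append)
      qed
    qed (use nonempty srt Q1 in auto)
    then show ?thesis
      using that[of Q1 r k] top corner Q1 last_in(3)[OF r(1)] r(2) by (simp add: add_cell_def)
  next
    case False
    define Q1 where "Q1 = Q[r := butlast (Q ! r)]"
    have nth: "Q1 ! i = (if i = r then butlast (Q ! r) else Q ! i)" if "i < length Q" for i
      using that by (simp add: Q1_def)
    have len: "length Q1 = length Q" by (simp add: Q1_def)
    have rows: "R = butlast (Q ! r) \<or> R \<in> set Q" if "R \<in> set Q1" for R
      using that set_update_subset_insert[of Q r "butlast (Q ! r)"] unfolding Q1_def by blast
    have Qr_in: "Q ! r \<in> set Q" using r(1) by simp
    have S: "\<forall>x\<in>set (butlast (Q ! r)). 0 < x"
      using bspec[OF nonempty Qr_in] in_set_butlastD[of _ "Q ! r"] by blast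
    have S': "sorted (butlast (Q ! r))"
      using bspec[OF srt Qr_in] by (rule sorted_butlast)
    have "semistandard Q1"
      unfolding semistandard_def is_tableau_def
    proof (intro conjI)
      show "\<forall>R\<in>set Q1. R \<noteq> [] \<and> (\<forall>x\<in>set R. 0 < x)" 
      proof
        fix R assume "R \<in> set Q1"
        from rows[OF this] show "R \<noteq> [] \<and> (\<forall>x\<in>set R. 0 < x)"
        proof
          assume "R = butlast (Q ! r)"
          then show ?thesis using False S by (simp only: simp_thms)
        next
          assume "R \<in> set Q"
          then show ?thesis by (rule bspec[OF nonempty])
        qed
      qed
      show "\<forall>R\<in>set Q1. sorted R" 
      proof
        fix R assume "R \<in> set Q1"
        from rows[OF this] show "sorted R"
        proof
          assume "R = butlast (Q ! r)"
          then show ?thesis using S' by (simp only: simp_thms)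
        next
          assume "R \<in> set Q"
          then show ?thesis by (rule bspec[OF srt])
        qed
      qed
      have "length (Q1 ! Suc i) \<le> length (Q1 ! i)" if "Suc i < length Q" for i
        using that nth shp'[OF that] corner by (auto simp: le_diff_conv)
      then have "shape Q1 ! Suc i \<le> shape Q1 ! i" if "Suc i < length (shape Q1)" for i
        using that len by (simp add: shape_def)
      then show "sorted_wrt (\<ge>) (shape Q1)"
        by (subst sorted_wrt_iff_nth_Suc_transp) auto
      show "\<forall>i j. i + 1 < length Q1 \<and> j < length (Q1 ! (i + 1)) \<longrightarrow> Q1 ! i ! j < Q1 ! (i + 1) ! j"
      proof (intro allI impI)
        fix i j assume "i + 1 < length Q1 \<and> j < length (Q1 ! (i + 1))"
        then have ij: "i + 1 < length Q" "j < length (Q1 ! (i + 1))" using len by auto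
        have j2: "j < length (Q ! (i + 1))" using ij nth by (auto split: if_splits)
        have "Q1 ! (i + 1) ! j = Q ! (i + 1) ! j" using ij nth by (auto simp: nth_butlast)
        moreover have "Q1 ! i ! j = Q ! i ! j"
          using ij nth corner j2 by (auto intro!: nth_butlast)
        ultimately show "Q1 ! i ! j < Q1 ! (i + 1) ! j" using col[OF ij(1) j2] by simp
      qed
    qed
    moreover have "add_cell r k Q1 = Q" using r(1) Qr[symmetric] by (simp add: add_cell_def Q1_def)
    ultimately show ?thesis using that top corner last_in(3)[OF r(1)] r len by simp
  qed
qed

section \<open>The bijection\<close>

lemma fc_decreasing_biwords_iff:
  "w \<in> fc_decreasing_biwords \<longleftrightarrow> (\<forall>(k, h)\<in>set w. 0 < k \<and> 0 < h) \<and>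
     successively (\<lambda>c d. fst d \<le> fst c \<and> (fst c = fst d \<longrightarrow> snd d < snd c)) w \<and> good (map snd w)"
  unfolding fc_decreasing_biwords_def successively_conv_nth fully_commutative_iff_good
  by auto

lemma fc_decreasing_biwords_tl: "c # w \<in> fc_decreasing_biwords \<Longrightarrow> w \<in> fc_decreasing_biwords"
  using good_factor[of "[snd c]" "map snd w" "[]"]
  by (cases w) (auto simp: fc_decreasing_biwords_iff)

lemma star_insertion_simps:
  "star_insertion [] = ([], [])"
  "star_insertion w = (P, Q) \<Longrightarrow> star_insert_letter x P = (P', r) \<Longrightarrow>
     star_insertion ((k, x) # w) = (P', add_cell r k Q)"
  by (simp_all add: star_insertion_def star_insert_column_def)

lemma tab_shape:
  assumes "tab P" shows "sorted_wrt (\<ge>) (shape P)" "0 \<notin> set (shape P)"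
  using assms unfolding transpose_semistandard_iff_tab[symmetric]
  by (auto simp: transpose_semistandard_def is_tableau_def shape_def)

lemma star_insertion_ConsE:
  assumes "star_insertion ((k, x) # w) = (P, Q)"
  obtains P0 Q0 r where "star_insertion w = (P0, Q0)" "star_insert_letter x P0 = (P, r)"
    "Q = add_cell r k Q0"
proof -
  obtain P0 Q0 where 1: "star_insertion w = (P0, Q0)" by fastforce
  obtain P' r where 2: "star_insert_letter x P0 = (P', r)" by fastforce
  show ?thesis using that assms 1 2 star_insertion_simps(2)[OF 1 2, of k] by simp
qed

lemma good_rev_letters: "(k, x) # w \<in> fc_decreasing_biwords \<Longrightarrow> good (rev (map snd w) @ [x])"
  using good_rev[of "x # map snd w"] by (auto simp: fc_decreasing_biwords_iff)

lemma star_insertion_tab: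
  assumes "w \<in> fc_decreasing_biwords" "star_insertion w = (P, Q)"
  shows "tab P \<and> shape P = shape Q \<and> hecke_equiv (row_word P) (rev (map snd w))"
  using assms
proof (induction w arbitrary: P Q)
  case Nil
  then show ?case by (auto simp: star_insertion_simps)
next
  case (Cons c w)
  obtain k x where c: "c = (k, x)" by fastforce
  from Cons.prems(2)[unfolded c] obtain P0 Q0 r where PQ0: "star_insertion w = (P0, Q0)"
    and ins: "star_insert_letter x P0 = (P, r)" and Q: "Q = add_cell r k Q0"
    by (rule star_insertion_ConsE)
  have P0: "tab P0" "shape P0 = shape Q0" "hecke_equiv (row_word P0) (rev (map snd w))"
    using Cons.IH[OF fc_decreasing_biwords_tl[OF Cons.prems(1)] PQ0] by auto
  have x: "0 < x" using Cons.prems(1) c by (auto simp: fc_decreasing_biwords_iff)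
  have eq: "hecke_equiv (row_word P0 @ [x]) (rev (map snd w) @ [x])"
    by (intro hecke_equiv_append P0 hecke_equiv_refl)
  then have "good (row_word P0 @ [x])"
    using good_rev_letters Cons.prems(1) c good_hecke_equiv by blast
  then have P: "tab P" "hecke_equiv (row_word P0 @ [x]) (row_word P)"
    using star_insert_letter_tab P0(1) x ins by blast+
  moreover have "hecke_equiv (row_word P) (rev (map snd (c # w)))"
    using hecke_equiv_trans[OF hecke_equiv_sym[OF P(2)] eq] c by simp
  moreover have "shape P = shape Q"
    using star_insert_letter_shape[OF ins] P0(2) Q by (simp add: shape_add_cell)
  ultimately show ?case by blast
qed

lemma star_insertion_good:
  assumes "(k, x) # w \<in> fc_decreasing_biwords" "star_insertion w = (P, Q)"
  shows "good (row_word P @ [x])"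
proof -
  have "hecke_equiv (row_word P @ [x]) (rev (map snd w) @ [x])"
    using star_insertion_tab fc_decreasing_biwords_tl assms by (blast intro: hecke_equiv_append)
  then show ?thesis using good_rev_letters assms(1) good_hecke_equiv by blast
qed

text \<open>The right-hand column is inserted first, hence the order \<open>[x', x]\<close> required
  by \<open>star_insert_letter_pieri\<close>.\<close>

lemma star_insertion_good2:
  assumes "(k, x) # (k', x') # w \<in> fc_decreasing_biwords" "star_insertion w = (P, Q)"
  shows "good (row_word P @ [x', x])"
proof -
  have w: "w \<in> fc_decreasing_biwords" using assms(1) by (blast dest: fc_decreasing_biwords_tl)
  have "hecke_equiv (row_word P @ [x', x]) (rev (map snd w) @ [x', x])"
    using star_insertion_tab w assms by (blast intro: hecke_equiv_append)
  then show ?thesis using good_rev_letters[OF assms(1)] good_hecke_equiv by simp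
qed

text \<open>The second conjunct locates the latest cell for the next step. If the top entry grows,
  all old entries are smaller. If it repeats, the bottom letters enter increasingly, so
  \<open>star_insert_letter_pieri\<close> gives \<open>r \<le> r'\<close>, and rows below
  \<open>r'\<close> already end in smaller entries.\<close>

lemma star_insertion_semistandard:
  assumes "w \<in> fc_decreasing_biwords" "star_insertion w = (P, Q)"
  shows "semistandard Q \<and>
    (\<forall>k x w' P0 Q0 r. w = (k, x) # w' \<longrightarrow> star_insertion w' = (P0, Q0) \<longrightarrow>
      star_insert_letter x P0 = (P, r) \<longrightarrow> top_cell k r Q)"
  using assms
proof (induction w arbitrary: P Q)
  case Nil
  then show ?case by (auto simp: star_insertion_simps semistandard_def is_tableau_def)
next
  case C: (Cons c w)
  obtain k x where c: "c = (k, x)" by fastforce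
  from C.prems(2)[unfolded c] obtain P0 Q0 r where PQ0: "star_insertion w = (P0, Q0)"
    and ins: "star_insert_letter x P0 = (P, r)" and Q: "Q = add_cell r k Q0"
    by (rule star_insertion_ConsE)
  have w: "w \<in> fc_decreasing_biwords" using C.prems(1) by (rule fc_decreasing_biwords_tl)
  note IH = C.IH[OF w PQ0]
  have Q0: "semistandard Q0" using IH by blast
  have k: "0 < k" using C.prems(1) c by (auto simp: fc_decreasing_biwords_iff)
  have len: "length P0 = length Q0" using star_insertion_tab[OF w PQ0] by (metis shape_simps(3))
  have r: "r \<le> length Q0" using star_insert_letter_shape[OF ins] len by simp
  have ne: "\<forall>R\<in>set Q0. R \<noteq> []" using Q0 by (simp add: semistandard_def is_tableau_def)
  have "(\<forall>R\<in>set Q0. \<forall>z\<in>set R. z \<le> k) \<and> (\<forall>i<r. last (Q0 ! i) < k)"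
  proof (cases w)
    case Nil
    then show ?thesis using PQ0 r by (simp add: star_insertion_simps)
  next
    case W: (Cons c' w2)
    obtain k' x' where c': "c' = (k', x')" by fastforce
    from PQ0[unfolded W c'] obtain P2 Q2 r' where PQ2: "star_insertion w2 = (P2, Q2)"
      and ins2: "star_insert_letter x' P2 = (P0, r')" by (rule star_insertion_ConsE)
    have top: "top_cell k' r' Q0" using IH W c' PQ2 ins2 by blast
    have dec: "k' \<le> k" "k = k' \<longrightarrow> x' < x"
      using C.prems(1) unfolding W c c' by (auto simp: fc_decreasing_biwords_iff)
    show ?thesis
    proof (cases "k = k'")
      case False
      have "last (Q0 ! i) \<le> k'" if "i < r" for i
      proof -
        have "i < length Q0" using that r by simp
        then have "last (Q0 ! i) \<in> set (Q0 ! i)" "Q0 ! i \<in> set Q0" using ne by simp_all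
        then show ?thesis using top unfolding top_cell_def by blast
      qed
      then show ?thesis using top False dec(1) unfolding top_cell_def by fastforce
    next
      case True
      have "tab P2" using star_insertion_tab w W fc_decreasing_biwords_tl PQ2 by blast
      moreover have "good (row_word P2 @ [x', x])"
        using star_insertion_good2 C.prems(1) PQ2 unfolding W c c' by blast
      ultimately have "r \<le> r'" using star_insert_letter_pieri ins2 ins dec(2) True by blast
      then show ?thesis using top True unfolding top_cell_def by simp
    qed
  qed
  moreover have "sorted_wrt (\<ge>) (shape Q)"
    using star_insertion_tab[OF C.prems] tab_shape(1) by metis
  ultimately have "semistandard Q \<and> top_cell k r Q"
    using semistandard_add_cell[OF Q0 r] k Q by blast
  moreover have "k1 = k \<and> r1 = r" if "c # w = (k1, x1) # w'" "star_insertion w' = (P1, Q1)"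
      "star_insert_letter x1 P1 = (P, r1)" for k1 x1 w' P1 Q1 r1
    using that c PQ0 ins by auto
  ultimately show ?case by blast
qed

text \<open>By \<open>top_cell_unique\<close> the common \<open>Q\<close> determines the last top
  entry and its row; \<open>star_insert_letter_inj\<close> then recovers the letter and the smaller
  tableau.\<close>

lemma star_insertion_inj:
  assumes "v \<in> fc_decreasing_biwords" "w \<in> fc_decreasing_biwords" "star_insertion v = star_insertion w"
  shows "v = w"
  using assms
proof (induction v arbitrary: w)
  case Nil
  show ?case
  proof (cases w)
    case (Cons c u)
    obtain k x where "c = (k, x)" by fastforce
    then have "star_insertion ((k, x) # u) = ([], [])"
      using Nil.prems(3) Cons by (simp add: star_insertion_simps)
    then obtain r Q0 where "[] = add_cell r k Q0" by (rule star_insertion_ConsE)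
    then have False by (cases Q0) (auto simp: add_cell_def split: if_splits nat.splits)
    then show ?thesis ..
  qed simp
next
  case (Cons c v)
  obtain k x where c: "c = (k, x)" by fastforce
  obtain P Q where PQ: "star_insertion (c # v) = (P, Q)" by fastforce
  then have PQw: "star_insertion w = (P, Q)" using Cons.prems(3) by simp
  from PQ[unfolded c] obtain P1 Q1 r1 where 1: "star_insertion v = (P1, Q1)"
    "star_insert_letter x P1 = (P, r1)" "Q = add_cell r1 k Q1" by (rule star_insertion_ConsE)
  have "Q \<noteq> []" using 1(3) by (auto simp: add_cell_def)
  then obtain d u where w: "w = d # u" using PQw by (cases w) (auto simp: star_insertion_simps)
  obtain k' x' where d: "d = (k', x')" by fastforce
  from PQw[unfolded w d] obtain P2 Q2 r2 where 2: "star_insertion u = (P2, Q2)"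
    "star_insert_letter x' P2 = (P, r2)" "Q = add_cell r2 k' Q2" by (rule star_insertion_ConsE)
  have ss: "[] \<notin> set Q" "top_cell k r1 Q"
    using star_insertion_semistandard[OF Cons.prems(1) PQ] c 1
    by (auto simp: semistandard_def is_tableau_def)
  have "top_cell k' r2 Q" using star_insertion_semistandard[OF Cons.prems(2) PQw] w d 2 by blast
  then have kr: "k = k'" "r1 = r2" using top_cell_unique ss by blast+
  have v: "v \<in> fc_decreasing_biwords" and u: "u \<in> fc_decreasing_biwords"
    using Cons.prems w by (blast dest: fc_decreasing_biwords_tl)+
  have tabs: "tab P1" "tab P2" "shape P1 = shape Q1" "shape P2 = shape Q2"
    using star_insertion_tab u v 1 2 by blast+
  have "P1 = P2 \<and> x = x'"
    using star_insert_letter_inj[OF tabs(1,2)] star_insertion_good Cons.prems(1,2) c d w 1 2 kr by blast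
  moreover from this have "length Q1 = length Q2" using tabs by (metis shape_simps(3))
  then have "Q1 = Q2" using add_cell_inj 1(3) 2(3) kr by metis
  ultimately have "star_insertion v = star_insertion u" using 1 2 by simp
  then show ?case using Cons.IH v u kr c d w \<open>P1 = P2 \<and> x = x'\<close> by blast
qed

lemma sum_list_add_box: "sum_list (add_box r s) = Suc (sum_list s)"
  by (auto simp: add_box_def sum_list_update)

text \<open>Induction on the number of cells: the top cell of \<open>Q\<close> names the row at
  which insertion into \<open>P\<close> is undone. The remaining point is that prepending the
  recovered column keeps the biword decreasing.\<close>

lemma star_insertion_surj:
  assumes "tab P" "good (row_word P)" "semistandard Q" "shape P = shape Q"
  shows "\<exists>w\<in>fc_decreasing_biwords. star_insertion w = (P, Q)"
  using assms
proof (induction "sum_list (shape Q)" arbitrary: P Q rule: less_induct)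
  case less
  note L = less.prems
  show ?case
  proof (cases "Q = []")
    case True
    then have "P = []" using L(4) by (cases P) auto
    then show ?thesis using True
      by (intro bexI[of _ "[]"]) (auto simp: star_insertion_simps fc_decreasing_biwords_iff good_def)
  next
    case False
    from L(3) False obtain k r Q' where Q': "semistandard Q'" "add_cell r k Q' = Q" "top_cell k r Q"
      "r \<le> length Q'" "0 < k" "Suc r < length Q \<longrightarrow> length (Q ! Suc r) < length (Q ! r)"
      by (rule semistandard_remove_cell)
    have len: "length P = length Q" using L(4) by (metis shape_simps(3))
    have "length (P ! i) = length (Q ! i)" if "i < length Q" for i
      using that L(4) len unfolding shape_def by (metis nth_map)
    then have corner: "Suc r < length P \<Longrightarrow> length (P ! Suc r) < length (P ! r)"
      using Q'(6) len by simp
    have "r < length P" using Q'(3) len by (simp add: top_cell_def)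
    from star_insert_letter_surj[OF L(1,2) this corner] obtain P' x where P': "tab P'"
      "star_insert_letter x P' = (P, r)" "0 < x" "hecke_equiv (row_word P) (row_word P' @ [x])"
      by blast
    have gx: "good (row_word P' @ [x])" using P'(4) L(2) good_hecke_equiv by blast
    then have g: "good (row_word P')" using good_factor[of "[]" "row_word P'" "[x]"] by simp
    have sP: "r \<le> length P'" "shape P = add_box r (shape P')"
      using star_insert_letter_shape[OF P'(2)] by auto
    have sQ: "shape Q = add_box r (shape Q')" using Q'(2) shape_add_cell by metis
    have "0 \<notin> set (shape Q')"
      using Q'(1) by (auto simp: semistandard_def is_tableau_def shape_def)
    then have sPQ: "shape P' = shape Q'"
      using add_box_inj[of "shape P'" "shape Q'" r] tab_shape(2)[OF P'(1)] sP sQ Q'(4) L(4) by simp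
    have "sum_list (shape Q') < sum_list (shape Q)" using sQ sum_list_add_box by simp
    then obtain w where w: "w \<in> fc_decreasing_biwords" "star_insertion w = (P', Q')"
      using less.hyps P'(1) g Q'(1) sPQ by blast
    have eq: "hecke_equiv (row_word P' @ [x]) (rev (map snd w) @ [x])"
      using star_insertion_tab[OF w] by (blast intro: hecke_equiv_append)
    then have "good (rev (x # map snd w))" using gx good_hecke_equiv by simp
    then have gw: "good (map snd ((k, x) # w))" using good_rev by fastforce
    have "fst d \<le> k \<and> (k = fst d \<longrightarrow> snd d < x)" if wd: "w = d # w2" for d w2
    proof -
      obtain k' x' where d: "d = (k', x')" by fastforce
      from w(2)[unfolded wd d] obtain P2 Q2 r' where 2: "star_insertion w2 = (P2, Q2)"
        "star_insert_letter x' P2 = (P', r')" by (rule star_insertion_ConsE)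
      have top: "top_cell k' r' Q'" using star_insertion_semistandard[OF w] wd d 2 by blast
      then have r': "r' < length Q'" "last (Q' ! r') = k'" by (auto simp: top_cell_def)
      have "Q' ! r' \<noteq> []" using Q'(1) r'(1) by (simp add: semistandard_def is_tableau_def)
      have row: "r' < length Q \<and> set (Q' ! r') \<subseteq> set (Q ! r') \<and> (r' \<noteq> r \<longrightarrow> Q ! r' = Q' ! r')"
        using r'(1) Q'(4) unfolding Q'(2)[symmetric] add_cell_def by (auto simp: nth_append nth_list_update)
      then have "k' \<in> set (Q ! r')" "Q ! r' \<in> set Q"
        using r'(2) \<open>Q' ! r' \<noteq> []\<close> last_in_set by force+
      then have kk: "k' \<le> k" using Q'(3) unfolding top_cell_def by blast
      \<comment> \<open>Otherwise the later cell would lie strictly above the earlier one, leaving a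
        row below \<open>r\<close> that also ends in \<open>k\<close>, against
        \<open>top_cell k r Q\<close>.\<close>
      moreover have "x' < x" if "k = k'"
      proof (rule ccontr)
        assume n: "\<not> x' < x"
        have w2: "w2 \<in> fc_decreasing_biwords" using w(1) wd fc_decreasing_biwords_tl by blast
        have tab2: "tab P2" "hecke_equiv (row_word P2) (rev (map snd w2))"
          using star_insertion_tab[OF w2 2(1)] by auto
        have "hecke_equiv (row_word P2 @ [x', x]) (rev (map snd w2) @ [x', x])"
          using tab2(2) by (blast intro: hecke_equiv_append)
        moreover have "good (rev (map snd w2) @ [x', x])"
          using \<open>good (rev (x # map snd w))\<close> wd d by simp
        ultimately have "good (row_word P2 @ [x', x])" using good_hecke_equiv by blast
        then have "r' < r" using star_insert_letter_pieri[OF tab2(1) _ 2(2) P'(2)] n by simp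
        then show False using Q'(3) row r'(2) that unfolding top_cell_def by auto
      qed
      ultimately show ?thesis using d by simp
    qed
    then have "(k, x) # w \<in> fc_decreasing_biwords"
      using w(1) gw P'(3) Q'(5) by (cases w) (auto simp: fc_decreasing_biwords_iff)
    moreover have "star_insertion ((k, x) # w) = (P, Q)"
      using star_insertion_simps(2)[OF w(2) P'(2)] Q'(2) by simp
    ultimately show ?thesis by blast
  qed
qed

theorem theorem3p16:
  shows "bij_betw star_insertion fc_decreasing_biwords fc_tableau_pairs"
proof (rule bij_betw_imageI)
  show "inj_on star_insertion fc_decreasing_biwords"
    using star_insertion_inj by (blast intro: inj_onI)
  have pairs: "(P, Q) \<in> fc_tableau_pairs \<longleftrightarrow>
    shape P = shape Q \<and> tab P \<and> semistandard Q \<and> good (row_word P)" for P Q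
    by (simp add: fc_tableau_pairs_def transpose_semistandard_iff_tab fully_commutative_iff_good)
  show "star_insertion ` fc_decreasing_biwords = fc_tableau_pairs"
  proof (intro equalityI subsetI)
    fix T assume "T \<in> star_insertion ` fc_decreasing_biwords"
    then obtain w P Q where w: "w \<in> fc_decreasing_biwords" "star_insertion w = (P, Q)" "T = (P, Q)"
      by (metis imageE surj_pair)
    \<comment> \<open>The row word is equivalent to the reversed bottom word, and the factor
      condition is symmetric under reversal.\<close>
    have "good (rev (map snd w))" using w(1) good_rev by (auto simp: fc_decreasing_biwords_iff)
    then have "good (row_word P)" using star_insertion_tab[OF w(1,2)] good_hecke_equiv by blast
    then show "T \<in> fc_tableau_pairs"
      using w star_insertion_tab[OF w(1,2)] star_insertion_semistandard[OF w(1,2)] pairs by blast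
  next
    fix T assume T: "T \<in> fc_tableau_pairs"
    obtain P Q where PQ: "T = (P, Q)" by fastforce
    then obtain w where "w \<in> fc_decreasing_biwords" "star_insertion w = (P, Q)"
      using T pairs star_insertion_surj by blast
    then show "T \<in> star_insertion ` fc_decreasing_biwords" using PQ by (metis imageI)
  qed
qed

end
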